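(* Let $\{(X_j,Y_j):j=1,\ldots,n\}$ follow the 2-exchangeable copula model with margins $F$ for the $X_j$ and $G$ for the $Y_j$, bivariate copula density $c^{(2)}$ and 1-exchangeable copula families $\{c^{(1)}_{1,1:n}\}$, $\{c^{(3)}_{1,1:n}\}$. Suppose that $C^{(2)}$ is the normal copula with correlation $\rho_2\in(-1,1)$ and that the margins are normal, $F(x)=\Phi\{(x-\mu_1)/\sigma_1\}$ and $G(y)=\Phi\{(y-\mu_2)/\sigma_2\}$, with $\sigma_1,\sigma_2>0$. Put $\beta_1=\rho_2\sigma_2/\sigma_1$, $\beta_0=\mu_2-\beta_1\mu_1$, $\sigma_e^2=\sigma_2^2(1-\rho_2^2)$, $\sigma_e>0$. (a) Conditionally on $(X_1,\ldots,X_n)=(x_1,\ldots,x_n)$, $$Y_j=\beta_0+\beta_1x_j+\sigma_e\Phi^{-1}(W_j),\qquad j=1,\ldots,n,$$ where $(W_1,\ldots,W_n)$ has density $c^{(3)}_{1,1:n}$; equivalently, the conditional density of $(Y_1,\ldots,Y_n)$ given $(X_1,\ldots,X_n)=(x_1,\ldots,x_n)$ is $$\frac{1}{(2\pi)^{n/2}\sigma_e^n}\exp\Big\{-\frac{1}{2\sigma_e^2}\sum_{j=1}^n(y_j-\beta_0-\beta_1x_j)^2\Big\}\,c^{(3)}_{1,1:n}\Big[\Phi\{(y_1-\beta_0-\beta_1x_1)/\sigma_e\},\ldots,\Phi\{(y_n-\beta_0-\beta_1x_n)/\sigma_e\}\Big].$$ (b) If moreover $c^{(3)}_{1,1:n}$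 is the density of the exchangeable normal copula with correlation $\rho_3\in[0,1)$, then, conditionally on $(X_1,\ldots,X_n)=(x_1,\ldots,x_n)$, $(Y_1,\ldots,Y_n)$ follows the normal linear mixed model with a random cluster intercept: it has the distribution of $$\big(\beta_0+\beta_1x_j+\sigma_e\sqrt{\rho_3}\,A+\sigma_e\sqrt{1-\rho_3}\,E_j\big)_{j=1,\ldots,n},$$ where $A,E_1,\ldots,E_n$ are independent $N(0,1)$ random variables.
   Context: $\Phi$ is the standard normal cdf. The normal copula with correlation matrix $R$ is the distribution of $(\Phi(S_1),\ldots,\Phi(S_n))$ with $(S_1,\ldots,S_n)\sim N(0,R)$; it is exchangeable with correlation $\rho_3$ when $R$ has ones on the diagonal and $\rho_3$ off the diagonal. The 2-exchangeable copula model: $U_j=F(X_j)$ and $V_j=G(Y_j)$ have joint density $$c_{2,1:n}\{(u_1,v_1),\ldots,(u_n,v_n)\}=c^{(1)}_{1,1:n}(u_1,\ldots,u_n)\prod_{j=1}^n c^{(2)}(u_j,v_j)\; c^{(3)}_{1,1:n}\{C_{2|1}(v_1|u_1),\ldots,C_{2|1}(v_n|u_n)\},$$ where $c^{(2)}$ is the density of the bivariate copula $C^{(2)}$, $C_{2|1}(v|u)=\partial C^{(2)}(u,v)/\partial u$, and $\{c^{(1)}_{1,1:n}\}$, $\{c^{(3)}_{1,1:n}\}$ are families of 1-exchangeable copula densities, i.e. $n$-variate copula densities of permutation-invariant distributions such that for $r\le n$ the $r$-variate margin of $c_{1,1:n}$ is $c_{1,1:r}$. Conditional statements hold for almost every $(x_1,\ldots,x_n)$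 with respect to the law of $(X_1,\ldots,X_n)$. *)

theory Defs
  imports "HOL-Probability.Probability" "Jordan_Normal_Form.Gauss_Jordan_Elimination"
    "Jordan_Normal_Form.Determinant"
begin

(* Vectors of R^n are extensional functions on {..<n}, i.e. elements of the space of
   PiM {..<n} (\<lambda>_. borel); the coordinates 1,...,n become 0,...,n-1. *)
abbreviation vec_borel :: "nat \<Rightarrow> (nat \<Rightarrow> real) measure" where
  "vec_borel n \<equiv> PiM {..<n} (\<lambda>_. borel)"

abbreviation vec_lborel :: "nat \<Rightarrow> (nat \<Rightarrow> real) measure" where
  "vec_lborel n \<equiv> PiM {..<n} (\<lambda>_. lborel)"

definition std_normal_cdf :: "real \<Rightarrow> real" ("\<Phi>") where
  "\<Phi> = cdf std_normal_distribution"

definition std_normal_quantile :: "real \<Rightarrow> real" where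
  "std_normal_quantile = the_inv_into UNIV \<Phi>"

definition uniform01 :: "real measure" where
  "uniform01 = uniform_measure lborel {0<..<1}"

text \<open>Copula densities are densities with respect to Lebesgue measure on the open unit cube;
  their values outside the cube are irrelevant.\<close>

definition copula_law :: "nat \<Rightarrow> ((nat \<Rightarrow> real) \<Rightarrow> real) \<Rightarrow> (nat \<Rightarrow> real) measure" where
  "copula_law n c = density (PiM {..<n} (\<lambda>_. uniform01)) (\<lambda>u. ennreal (c u))"

definition copula_density :: "nat \<Rightarrow> ((nat \<Rightarrow> real) \<Rightarrow> real) \<Rightarrow> bool" where
  "copula_density n c \<longleftrightarrow>
     c \<in> borel_measurable (vec_borel n) \<and>
     (\<forall>u \<in> PiE {..<n} (\<lambda>_. {0<..<1}). 0 \<le> c u) \<and>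
     prob_space (copula_law n c) \<and>
     (\<forall>j<n. distr (copula_law n c) borel (\<lambda>u. u j) = uniform01)"

definition one_exchangeable_family :: "(nat \<Rightarrow> (nat \<Rightarrow> real) \<Rightarrow> real) \<Rightarrow> bool" where
  "one_exchangeable_family c \<longleftrightarrow>
     (\<forall>n\<ge>1. copula_density n (c n) \<and>
        (\<forall>\<pi>. \<pi> permutes {..<n} \<longrightarrow>
           distr (copula_law n (c n)) (vec_borel n) (\<lambda>u. \<lambda>j\<in>{..<n}. u (\<pi> j)) =
             copula_law n (c n)) \<and>
        (\<forall>r. 1 \<le> r \<and> r \<le> n \<longrightarrow>
           distr (copula_law n (c n)) (vec_borel r) (\<lambda>u. restrict u {..<r}) =
             copula_law r (c r)))"

definition bivariate_copula_law :: "(real \<Rightarrow> real \<Rightarrow> real) \<Rightarrow> (real \<times> real) measure" where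
  "bivariate_copula_law c = density (uniform01 \<Otimes>\<^sub>M uniform01) (\<lambda>(u, v). ennreal (c u v))"

definition bivariate_copula ::
    "(real \<Rightarrow> real \<Rightarrow> real) \<Rightarrow> (real \<Rightarrow> real \<Rightarrow> real) \<Rightarrow> bool" where
  "bivariate_copula C c \<longleftrightarrow>
     case_prod c \<in> borel_measurable (borel \<Otimes>\<^sub>M borel) \<and>
     (\<forall>u\<in>{0<..<1}. \<forall>v\<in>{0<..<1}. 0 \<le> c u v) \<and>
     prob_space (bivariate_copula_law c) \<and>
     distr (bivariate_copula_law c) borel fst = uniform01 \<and>
     distr (bivariate_copula_law c) borel snd = uniform01 \<and>
     (\<forall>u\<in>{0..1}. \<forall>v\<in>{0..1}. C u v = measure (bivariate_copula_law c) ({..u} \<times> {..v}))"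

text \<open>The law \<open>N(0, R)\<close> for a nonsingular correlation matrix \<open>R\<close>, given by its density; for
  a singular \<open>R\<close> the definition is meaningless.\<close>

definition centred_normal_law :: "real mat \<Rightarrow> (nat \<Rightarrow> real) measure" where
  "centred_normal_law R =
     (let n = dim_row R; Q = the (mat_inverse R) in
      density (vec_lborel n)
        (\<lambda>s. ennreal (exp (- (\<Sum>i<n. \<Sum>j<n. s i * Q $$ (i, j) * s j) / 2) /
                sqrt ((2 * pi) ^ n * Determinant.det R))))"

definition normal_copula :: "real mat \<Rightarrow> (nat \<Rightarrow> real) measure" where
  "normal_copula R =
     distr (centred_normal_law R) (vec_borel (dim_row R)) (\<lambda>s. \<lambda>j\<in>{..<dim_row R}. \<Phi> (s j))"

definition exchangeable_corr_mat :: "nat \<Rightarrow> real \<Rightarrow> real mat" where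
  "exchangeable_corr_mat n \<rho> = mat n n (\<lambda>(i, j). if i = j then 1 else \<rho>)"

definition bivariate_normal_copula :: "real \<Rightarrow> real \<Rightarrow> real \<Rightarrow> real" where
  "bivariate_normal_copula \<rho> u v =
     (let N = normal_copula (exchangeable_corr_mat 2 \<rho>)
      in measure N {w \<in> space N. w 0 \<le> u \<and> w 1 \<le> v})"

definition cond_cdf_2_1 :: "(real \<Rightarrow> real \<Rightarrow> real) \<Rightarrow> real \<Rightarrow> real \<Rightarrow> real" where
  "cond_cdf_2_1 C v u = deriv (\<lambda>t. C t v) u"

definition two_exchangeable_density ::
    "nat \<Rightarrow> (nat \<Rightarrow> (nat \<Rightarrow> real) \<Rightarrow> real) \<Rightarrow> (real \<Rightarrow> real \<Rightarrow> real) \<Rightarrow> (real \<Rightarrow> real \<Rightarrow> real) \<Rightarrow>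
     (nat \<Rightarrow> (nat \<Rightarrow> real) \<Rightarrow> real) \<Rightarrow> (nat \<Rightarrow> real) \<Rightarrow> (nat \<Rightarrow> real) \<Rightarrow> real" where
  "two_exchangeable_density n c1 C2 c2 c3 u v =
     (if \<forall>j<n. u j \<in> {0<..<1} \<and> v j \<in> {0<..<1}
      then c1 n u * (\<Prod>j<n. c2 (u j) (v j)) * c3 n (\<lambda>j\<in>{..<n}. cond_cdf_2_1 C2 (v j) (u j))
      else 0)"

definition rvec :: "nat \<Rightarrow> (nat \<Rightarrow> 'a \<Rightarrow> real) \<Rightarrow> 'a \<Rightarrow> (nat \<Rightarrow> real)" where
  "rvec n X \<omega> = (\<lambda>j\<in>{..<n}. X j \<omega>)"

text \<open>The joint density is taken on \<open>R^n \<times> R^n\<close>, i.e. the pairs \<open>(u_j, v_j)\<close> are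
  regrouped as \<open>(u, v)\<close>.\<close>

definition two_exchangeable_copula_model ::
    "'a measure \<Rightarrow> nat \<Rightarrow> (real \<Rightarrow> real) \<Rightarrow> (real \<Rightarrow> real) \<Rightarrow>
     (nat \<Rightarrow> (nat \<Rightarrow> real) \<Rightarrow> real) \<Rightarrow> (real \<Rightarrow> real \<Rightarrow> real) \<Rightarrow> (real \<Rightarrow> real \<Rightarrow> real) \<Rightarrow>
     (nat \<Rightarrow> (nat \<Rightarrow> real) \<Rightarrow> real) \<Rightarrow> (nat \<Rightarrow> 'a \<Rightarrow> real) \<Rightarrow> (nat \<Rightarrow> 'a \<Rightarrow> real) \<Rightarrow> bool" where
  "two_exchangeable_copula_model M n F G c1 C2 c2 c3 X Y \<longleftrightarrow>
     prob_space M \<and>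
     (\<forall>j<n. X j \<in> borel_measurable M \<and> cdf (distr M borel (X j)) = F) \<and>
     (\<forall>j<n. Y j \<in> borel_measurable M \<and> cdf (distr M borel (Y j)) = G) \<and>
     bivariate_copula C2 c2 \<and>
     one_exchangeable_family c1 \<and> one_exchangeable_family c3 \<and>
     distributed M (vec_lborel n \<Otimes>\<^sub>M vec_lborel n)
       (\<lambda>\<omega>. (rvec n (\<lambda>j \<omega>. F (X j \<omega>)) \<omega>, rvec n (\<lambda>j \<omega>. G (Y j \<omega>)) \<omega>))
       (\<lambda>(u, v). ennreal (two_exchangeable_density n c1 C2 c2 c3 u v))"

text \<open>The kernel \<open>K\<close> is a version of the conditional law of \<open>Y\<close> given \<open>X\<close>. For
  the spaces used here such a kernel is unique up to null sets of the law of \<open>X\<close>.\<close>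

definition regular_cond_law ::
    "'a measure \<Rightarrow> 'b measure \<Rightarrow> ('a \<Rightarrow> 'b) \<Rightarrow> 'c measure \<Rightarrow> ('a \<Rightarrow> 'c) \<Rightarrow> ('b \<Rightarrow> 'c measure) \<Rightarrow> bool" where
  "regular_cond_law M S X T Y K \<longleftrightarrow>
     X \<in> measurable M S \<and> Y \<in> measurable M T \<and> K \<in> measurable S (prob_algebra T) \<and>
     (\<forall>A\<in>sets S. \<forall>B\<in>sets T.
        emeasure M (X -` A \<inter> Y -` B \<inter> space M) =
          (\<integral>\<^sup>+ x \<in> A. emeasure (K x) B \<partial>distr M S X))"

end

theory Submission
  imports Defs
begin

text \<open>
  With \<open>h(u, v) = \<Phi> ((\<Phi>\<^sup>-\<^sup>1 v - \<rho> \<Phi>\<^sup>-\<^sup>1 u) / sqrt (1 - \<rho>\<^sup>2))\<close> the bivariate normal copula is the image of the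
  uniform law on the unit square under the inverse, in the second argument, of
  \<open>(u, v) \<mapsto> (u, h(u, v))\<close>, and \<open>C\<^sub>2\<^sub>|\<^sub>1 = h\<close>. Taking the \<open>n\<close>-fold product of this fact and multiplying by the
  density factors \<open>c\<^sub>1(u)\<close> and \<open>c\<^sub>3(h(u, v))\<close> shows that \<open>U\<close> and \<open>W = h(U, V)\<close> are independent with
  densities \<open>c\<^sub>1\<close> and \<open>c\<^sub>3\<close>; no formula for the density \<open>c\<^sub>2\<close> is needed. For normal margins
  \<open>W\<^sub>j = \<Phi> ((Y\<^sub>j - \<beta>\<^sub>0 - \<beta>\<^sub>1 X\<^sub>j) / \<sigma>\<^sub>e)\<close>, so the conditional law of \<open>Y\<close> given \<open>X = x\<close> is an affine image of the
  law with density \<open>c\<^sub>3\<close>. In part (b), integrating out the intercept \<open>A\<close> by completing the square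
  gives the quadratic form of the inverse of the exchangeable correlation matrix.
\<close>

section \<open>The standard normal cdf and quantile function\<close>

text \<open>The identity for \<open>C2\<close> on the closed unit square fixes the law of a pair,
  but fixes its density only almost everywhere; so \<open>c2\<close> enters through
  \<open>bivariate_copula_law\<close>, and the step from \<open>C2\<close> to that law is a
  uniqueness argument for measures. By contrast \<open>cond_cdf_2_1\<close> is a pointwise
  derivative and is computed at every interior point. The map (u, v) to (u, h(u, v)) is the
  Rosenblatt transform of the pair. Conditioning on X amounts to conditioning on U because the
  normal margin F is injective, and independence turns the conditional law of W given X into a
  constant kernel. The normalising constant of the n-variate normal density is never computed: in
  part (b) the law N(0, R) has mass one because its coordinatewise image under \<Phi> is the copula
  law with density \<open>c3 n\<close>, a probability measure.\<close>

lemma measure_std_normal_Ioc_pos: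
  assumes "x < y"
  shows "0 < measure std_normal_distribution {x<..y}"
proof -
  interpret real_distribution std_normal_distribution by (rule real_dist_normal_dist)
  have "emeasure std_normal_distribution {x<..y} \<noteq> 0"
  proof
    assume "emeasure std_normal_distribution {x<..y} = 0"
    then have "{x<..y} \<in> null_sets std_normal_distribution" by auto
    then have "AE z in lborel. z \<in> {x<..y} \<longrightarrow> ennreal (std_normal_density z) = 0"
      by (simp add: null_sets_density_iff)
    moreover have "ennreal (std_normal_density z) \<noteq> 0" for z
      using normal_density_pos[of 1 0 z] by (simp add: ennreal_eq_0_iff not_le)
    ultimately have "AE z in lborel. z \<notin> {x<..y}"
      by simp
    then have "emeasure lborel {x<..y} = 0"
      by (subst (asm) AE_iff_null_sets[symmetric]) auto
    then show False using assms by simp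
  qed
  then show ?thesis by (simp add: emeasure_eq_measure measure_nonneg less_le)
qed

lemma strict_mono_Phi: "strict_mono \<Phi>"
proof (rule strict_monoI)
  fix x y :: real assume "x < y"
  interpret real_distribution std_normal_distribution by (rule real_dist_normal_dist)
  show "\<Phi> x < \<Phi> y"
    using measure_std_normal_Ioc_pos[OF \<open>x < y\<close>] cdf_diff_eq[OF \<open>x < y\<close>]
    by (simp add: std_normal_cdf_def)
qed

lemma Phi_less_iff [simp]: "\<Phi> x < \<Phi> y \<longleftrightarrow> x < y"
  and Phi_le_iff [simp]: "\<Phi> x \<le> \<Phi> y \<longleftrightarrow> x \<le> y"
  and Phi_eq_iff [simp]: "\<Phi> x = \<Phi> y \<longleftrightarrow> x = y"
  using strict_mono_less[OF strict_mono_Phi] strict_mono_less_eq[OF strict_mono_Phi] 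
    strict_mono_eq[OF strict_mono_Phi] by auto

lemma Phi_in_unit: "\<Phi> x \<in> {0<..<1}"
proof -
  interpret real_distribution std_normal_distribution by (rule real_dist_normal_dist)
  \<comment> \<open>The general bounds for a cdf are not strict; comparison with the points x - 1
    and x + 1 makes them strict.\<close>
  have "0 \<le> \<Phi> (x - 1)" "\<Phi> (x + 1) \<le> 1"
    using cdf_nonneg cdf_bounded_prob by (auto simp: std_normal_cdf_def)
  moreover have "\<Phi> (x - 1) < \<Phi> x" "\<Phi> x < \<Phi> (x + 1)" by auto
  ultimately show ?thesis by (auto simp del: Phi_less_iff)
qed

lemma Phi_pos [simp]: "0 < \<Phi> x" and Phi_less_1 [simp]: "\<Phi> x < 1"
  using Phi_in_unit[of x] by auto

text \<open>A cdf is continuous at x exactly when the law has no atom there, and a law with a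
  Lebesgue density has no atoms.\<close>

lemma isCont_Phi: "isCont \<Phi> x"
proof -
  interpret real_distribution std_normal_distribution by (rule real_dist_normal_dist)
  have "AE z in lborel. z \<in> {x} \<longrightarrow> ennreal (std_normal_density z) = 0"
    using AE_lborel_singleton[of x] by eventually_elim auto
  then have "emeasure std_normal_distribution {x} = 0"
    using null_sets_density_iff[of "\<lambda>z. ennreal (std_normal_density z)" lborel "{x}"]
    by (auto simp: null_sets_def)
  then show ?thesis unfolding std_normal_cdf_def isCont_cdf by (simp add: measure_def)
qed

lemma continuous_on_Phi: "continuous_on A \<Phi>"
  using isCont_Phi continuous_at_imp_continuous_on by blast

lemma borel_measurable_Phi [measurable]: "\<Phi> \<in> borel_measurable borel"
  by (intro borel_measurable_continuous_onI continuous_on_Phi)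

lemma range_Phi: "range \<Phi> = {0<..<1}"
proof (intro equalityI subsetI)
  fix u :: real assume u: "u \<in> {0<..<1}"
  interpret real_distribution std_normal_distribution by (rule real_dist_normal_dist)
  have "eventually (\<lambda>x. \<Phi> x < u) at_bot"
    using order_tendstoD(2)[OF cdf_lim_at_bot] u by (simp add: std_normal_cdf_def)
  then obtain a where a: "\<Phi> a < u" by (auto simp: eventually_at_bot_linorder)
  have "eventually (\<lambda>x. \<Phi> x > u) at_top"
    using order_tendstoD(1)[OF cdf_lim_at_top_prob] u by (simp add: std_normal_cdf_def)
  then obtain b where b: "u < \<Phi> b" by (auto simp: eventually_at_top_linorder)
  have "a \<le> b" using a b by (metis Phi_le_iff less_imp_le order_trans linear)
  then obtain x where "\<Phi> x = u"
    using IVT'[of \<Phi> a u b] a b continuous_on_Phi by auto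
  then show "u \<in> range \<Phi>" by auto
qed (use Phi_in_unit in auto)

lemma quantile_Phi [simp]: "std_normal_quantile (\<Phi> x) = x"
  unfolding std_normal_quantile_def
  by (rule the_inv_into_f_f) (auto simp: inj_on_def)

lemma Phi_quantile [simp]: "u \<in> {0<..<1} \<Longrightarrow> \<Phi> (std_normal_quantile u) = u"
  using range_Phi by (metis imageE quantile_Phi)

lemma Phi_le_iff_quantile: "u \<in> {0<..<1} \<Longrightarrow> \<Phi> x \<le> u \<longleftrightarrow> x \<le> std_normal_quantile u"
  by (metis Phi_le_iff Phi_quantile)

lemma quantile_le_iff: "u \<in> {0<..<1} \<Longrightarrow> std_normal_quantile u \<le> x \<longleftrightarrow> u \<le> \<Phi> x"
  by (metis Phi_le_iff Phi_quantile)

lemma continuous_on_quantile: "continuous_on {0<..<1} std_normal_quantile"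
proof -
  have "isCont std_normal_quantile u" if "u \<in> {0<..<1}" for u
    using isCont_inverse_function[of 1 "std_normal_quantile u" std_normal_quantile \<Phi>] that isCont_Phi by simp
  then show ?thesis using continuous_at_imp_continuous_on by blast
qed

text \<open>Off the range of \<Phi> the description defining the inverse is unsatisfiable, so
  \<open>std_normal_quantile\<close> takes one and the same junk value there. This makes it Borel on
  the whole line.\<close>

lemma quantile_outside: "u \<notin> {0<..<1} \<Longrightarrow> std_normal_quantile u = (THE x. False)"
proof -
  assume "u \<notin> {0<..<1}"
  then have "\<Phi> x \<noteq> u" for x using Phi_in_unit[of x] by auto
  then show ?thesis by (simp add: std_normal_quantile_def the_inv_into_def)
qed

lemma borel_measurable_quantile [measurable]: "std_normal_quantile \<in> borel_measurable borel"
proof -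
  have "(\<lambda>u. if u \<in> {0<..<1} then std_normal_quantile u else (THE x. False)) \<in> borel_measurable borel"
    by (rule borel_measurable_continuous_on_if) 
      (auto intro: continuous_on_quantile continuous_on_const)
  also have "(\<lambda>u. if u \<in> {0<..<1} then std_normal_quantile u else (THE x. False)) = std_normal_quantile"
    using quantile_outside by auto
  finally show ?thesis .
qed

section \<open>The uniform law on the unit interval\<close>

lemma prob_space_uniform01: "prob_space uniform01"
  unfolding uniform01_def by (intro prob_space_uniform_measure) auto

lemma sets_uniform01 [simp, measurable_cong]: "sets uniform01 = sets borel"
  by (simp add: uniform01_def)

lemma space_uniform01 [simp]: "space uniform01 = UNIV"
  by (simp add: uniform01_def)

lemma uniform01_eq_density: "uniform01 = density lborel (indicator {0<..<1})"
  by (simp add: uniform01_def uniform_measure_def divide_ennreal_def)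

lemma AE_uniform01: "AE u in uniform01. u \<in> {0<..<1}"
  unfolding uniform01_def by (intro AE_uniform_measureI) auto

lemma real_distribution_uniform01: "real_distribution uniform01"
  using prob_space_uniform01 by (simp add: real_distribution_def real_distribution_axioms_def)

lemma cdf_uniform01: "cdf uniform01 u = (if u \<le> 0 then 0 else if u < 1 then u else 1)"
proof -
  have "{0<..<1} \<inter> {..u} = (if u \<le> 0 then {} else if u < 1 then {0<..u} else {0<..<1})"
    by auto
  then show ?thesis
    unfolding cdf_def uniform01_def
    by (subst measure_uniform_measure) auto
qed

text \<open>The probability integral transform. For u in the open unit interval the event \<Phi> x
  \<le> u is the half-line up to the quantile of u, whose mass is u; for other u it is empty or
  everything.\<close>

lemma distr_std_normal_Phi: "distr std_normal_distribution borel \<Phi> = uniform01"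
proof (rule cdf_unique)
  interpret N: real_distribution std_normal_distribution by (rule real_dist_normal_dist)
  show "real_distribution (distr std_normal_distribution borel \<Phi>)"
    by (rule N.real_distribution_distr) simp
  show "real_distribution uniform01" by (rule real_distribution_uniform01)
  show "cdf (distr std_normal_distribution borel \<Phi>) = cdf uniform01"
  proof
    fix u
    have *: "cdf (distr std_normal_distribution borel \<Phi>) u = measure std_normal_distribution {x. \<Phi> x \<le> u}"
      unfolding cdf_def by (subst measure_distr) (auto simp: vimage_def)
    consider "u \<le> 0" | "u \<in> {0<..<1}" | "1 \<le> u" by fastforce
    then show "cdf (distr std_normal_distribution borel \<Phi>) u = cdf uniform01 u"
    proof cases
      case 1
      then have "{x. \<Phi> x \<le> u} = {}" using Phi_pos by (auto simp: not_le intro: le_less_trans)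
      then show ?thesis using 1 unfolding * cdf_uniform01 by simp
    next
      case 2
      then have "{x. \<Phi> x \<le> u} = {..std_normal_quantile u}" by (auto simp: Phi_le_iff_quantile)
      then show ?thesis using 2 Phi_quantile[OF 2] unfolding * cdf_uniform01 
        by (simp add: std_normal_cdf_def cdf_def)
    next
      case 3
      then have "{x. \<Phi> x \<le> u} = UNIV" by (auto intro: order_trans[OF less_imp_le[OF Phi_less_1]])
      then show ?thesis using 3 N.prob_space unfolding * cdf_uniform01 by simp
    qed
  qed
qed

section \<open>Finite product measures\<close>

text \<open>Both measures agree on boxes, where the integral of a product of one-coordinate
  functions factorises. The assumptions range over all indices because the product locales ask for
  that; sigma-finiteness of the weighted factors gives uniqueness of the product measure.\<close>

lemma PiM_density:
  fixes M :: "'i \<Rightarrow> 'b measure" and f :: "'i \<Rightarrow> 'b \<Rightarrow> ennreal"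
  assumes "finite I" and M: "\<And>i. sigma_finite_measure (M i)"
    and f: "\<And>i. f i \<in> borel_measurable (M i)"
    and D: "\<And>i. sigma_finite_measure (density (M i) (f i))"
  shows "PiM I (\<lambda>i. density (M i) (f i)) = density (PiM I M) (\<lambda>x. \<Prod>i\<in>I. f i (x i))"
proof (rule sym)
  interpret M: product_sigma_finite M using M by (simp add: product_sigma_finite_def)
  interpret D: product_sigma_finite "\<lambda>i. density (M i) (f i)"
    using D by (simp add: product_sigma_finite_def)
  note f[measurable]
  show "density (PiM I M) (\<lambda>x. \<Prod>i\<in>I. f i (x i)) = PiM I (\<lambda>i. density (M i) (f i))"
  proof (rule D.PiM_eqI)
    show "sets (density (PiM I M) (\<lambda>x. \<Prod>i\<in>I. f i (x i))) = sets (PiM I (\<lambda>i. density (M i) (f i)))"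
      by (simp cong: sets_PiM_cong)
    fix A assume A: "\<And>i. i \<in> I \<Longrightarrow> A i \<in> sets (density (M i) (f i))"
    then have A': "PiE I A \<in> sets (PiM I M)"
      using \<open>finite I\<close> by (intro sets_PiM_I_finite) auto
    have "emeasure (density (PiM I M) (\<lambda>x. \<Prod>i\<in>I. f i (x i))) (PiE I A) =
      (\<integral>\<^sup>+x. (\<Prod>i\<in>I. f i (x i)) * indicator (PiE I A) x \<partial>PiM I M)"
      using A' by (subst emeasure_density) auto
    also have "\<dots> = (\<integral>\<^sup>+x. (\<Prod>i\<in>I. f i (x i) * indicator (A i) (x i)) \<partial>PiM I M)"
    proof (rule nn_integral_cong)
      fix x assume x: "x \<in> space (PiM I M)"
      have "indicator (PiE I A) x = (\<Prod>i\<in>I. indicator (A i) (x i) :: ennreal)"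
        using x \<open>finite I\<close> by (auto simp: space_PiM PiE_iff indicator_def prod_zero_iff)
      then show "(\<Prod>i\<in>I. f i (x i)) * indicator (PiE I A) x = (\<Prod>i\<in>I. f i (x i) * indicator (A i) (x i))"
        by (simp add: prod.distrib)
    qed
    also have "\<dots> = (\<Prod>i\<in>I. \<integral>\<^sup>+x. f i x * indicator (A i) x \<partial>M i)"
      using A \<open>finite I\<close> by (subst M.product_nn_integral_prod) auto
    also have "\<dots> = (\<Prod>i\<in>I. emeasure (density (M i) (f i)) (A i))"
      using A by (intro prod.cong refl) (auto simp: emeasure_density)
    finally show "emeasure (density (PiM I M) (\<lambda>x. \<Prod>i\<in>I. f i (x i))) (PiE I A) =
      (\<Prod>i\<in>I. emeasure (density (M i) (f i)) (A i))" .
  qed fact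
qed

lemma distr_PiM_componentwise:
  fixes M :: "'i \<Rightarrow> 'b measure" and N :: "'i \<Rightarrow> 'c measure"
  assumes "finite I" and M: "\<And>i. prob_space (M i)"
    and f: "\<And>i. f i \<in> measurable (M i) (N i)"
  shows "distr (PiM I M) (PiM I N) (\<lambda>x. \<lambda>i\<in>I. f i (x i)) = PiM I (\<lambda>i. distr (M i) (N i) (f i))"
proof -
  note f[measurable]
  interpret M: product_prob_space M
    using M by (simp add: product_prob_space_def product_prob_space_axioms_def product_sigma_finite_def prob_space_imp_sigma_finite)
  have "prob_space (distr (M i) (N i) (f i))" for i
    using M f by (intro prob_space.prob_space_distr)
  then interpret D: product_sigma_finite "\<lambda>i. distr (M i) (N i) (f i)"
    by (simp add: product_sigma_finite_def prob_space_imp_sigma_finite)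
  show ?thesis
  proof (rule D.PiM_eqI)
    show "sets (distr (PiM I M) (PiM I N) (\<lambda>x. \<lambda>i\<in>I. f i (x i))) = sets (PiM I (\<lambda>i. distr (M i) (N i) (f i)))"
      by (simp cong: sets_PiM_cong)
    fix A assume A: "\<And>i. i \<in> I \<Longrightarrow> A i \<in> sets (distr (M i) (N i) (f i))"
    have *: "(\<lambda>x. \<lambda>i\<in>I. f i (x i)) -` PiE I A \<inter> space (PiM I M) = PiE I (\<lambda>i. f i -` A i \<inter> space (M i))"
      by (auto simp: space_PiM PiE_iff extensional_def)
    show "emeasure (distr (PiM I M) (PiM I N) (\<lambda>x. \<lambda>i\<in>I. f i (x i))) (PiE I A) =
      (\<Prod>i\<in>I. emeasure (distr (M i) (N i) (f i)) (A i))"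
      using A \<open>finite I\<close>
      by (subst emeasure_distr) (auto simp: * emeasure_distr M.emeasure_PiM intro!: prod.cong sets_PiM_I_finite)
  qed fact
qed

text \<open>Regrouping of coordinates. It links R^n x R^n, where the joint density of the model
  lives, with the n-fold power of the plane, where the pair copula acts coordinatewise.\<close>

lemma distr_PiM_zip:
  fixes A :: "'i \<Rightarrow> 'b measure" and B :: "'i \<Rightarrow> 'c measure"
  assumes "finite I" and A: "\<And>i. sigma_finite_measure (A i)" and B: "\<And>i. sigma_finite_measure (B i)"
  shows "distr (PiM I A \<Otimes>\<^sub>M PiM I B) (PiM I (\<lambda>i. A i \<Otimes>\<^sub>M B i)) (\<lambda>(u, v). \<lambda>i\<in>I. (u i, v i)) =
    PiM I (\<lambda>i. A i \<Otimes>\<^sub>M B i)"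
proof -
  interpret A: product_sigma_finite A using A by (simp add: product_sigma_finite_def)
  interpret B: product_sigma_finite B using B by (simp add: product_sigma_finite_def)
  interpret IB: finite_product_sigma_finite B I by standard fact
  have "sigma_finite_measure (A i \<Otimes>\<^sub>M B i)" for i
    using A B by (intro sigma_finite_pair_measure)
  then interpret D: product_sigma_finite "\<lambda>i. A i \<Otimes>\<^sub>M B i"
    by (simp add: product_sigma_finite_def)
  show ?thesis
  proof (rule D.PiM_eqI)
    \<comment> \<open>The sides \<open>E i\<close> are arbitrary measurable sets of pairs, not
      rectangles, so the mass of the box is found by iterated integration.\<close>
    fix E assume E[measurable]: "\<And>i. i \<in> I \<Longrightarrow> E i \<in> sets (A i \<Otimes>\<^sub>M B i)"
    have [measurable]: "PiE I E \<in> sets (PiM I (\<lambda>i. A i \<Otimes>\<^sub>M B i))"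
      using E \<open>finite I\<close> by (intro sets_PiM_I_finite) auto
    let ?P = "PiM I A \<Otimes>\<^sub>M PiM I B" and ?z = "\<lambda>(u, v). \<lambda>i\<in>I. (u i, v i)"
    have [measurable]: "?z \<in> measurable ?P (PiM I (\<lambda>i. A i \<Otimes>\<^sub>M B i))"
      by measurable
    have ind: "indicator (PiE I E) (?z (u, v)) = (\<Prod>i\<in>I. indicator (E i) (u i, v i) :: ennreal)" for u v
      using \<open>finite I\<close> by (auto simp: PiE_iff indicator_def prod_zero_iff)
    have meas: "(\<lambda>v. indicator (E i) (a, v)) \<in> borel_measurable (B i)" if "i \<in> I" "a \<in> space (A i)" for i a
      using that E[of i] by measurable
    have "emeasure (distr ?P (PiM I (\<lambda>i. A i \<Otimes>\<^sub>M B i)) ?z) (PiE I E) =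
        (\<integral>\<^sup>+x. indicator (PiE I E) x \<partial>distr ?P (PiM I (\<lambda>i. A i \<Otimes>\<^sub>M B i)) ?z)"
      by simp
    also have "\<dots> = (\<integral>\<^sup>+w. indicator (PiE I E) (?z w) \<partial>?P)"
      by (rule nn_integral_distr) simp_all
    also have "\<dots> = (\<integral>\<^sup>+u. \<integral>\<^sup>+v. indicator (PiE I E) (?z (u, v)) \<partial>PiM I B \<partial>PiM I A)"
      by (subst IB.nn_integral_fst[symmetric]) auto
    also have "\<dots> = (\<integral>\<^sup>+u. (\<Prod>i\<in>I. \<integral>\<^sup>+v. indicator (E i) (u i, v) \<partial>B i) \<partial>PiM I A)"
    proof (rule nn_integral_cong)
      fix u assume "u \<in> space (PiM I A)"
      then have u: "u i \<in> space (A i)" if "i \<in> I" for i using that by (auto simp: space_PiM)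
      show "(\<integral>\<^sup>+v. indicator (PiE I E) (?z (u, v)) \<partial>PiM I B) =
        (\<Prod>i\<in>I. \<integral>\<^sup>+v. indicator (E i) (u i, v) \<partial>B i)"
        unfolding ind using \<open>finite I\<close> u
        by (intro B.product_nn_integral_prod meas) auto
    qed
    also have "\<dots> = (\<Prod>i\<in>I. \<integral>\<^sup>+a. \<integral>\<^sup>+v. indicator (E i) (a, v) \<partial>B i \<partial>A i)"
      using \<open>finite I\<close> B E
      by (intro A.product_nn_integral_prod sigma_finite_measure.borel_measurable_nn_integral_fst) auto
    also have "\<dots> = (\<Prod>i\<in>I. emeasure (A i \<Otimes>\<^sub>M B i) (E i))"
      using E B 
      by (intro prod.cong refl) (simp add: sigma_finite_measure.emeasure_pair_measure)
    finally show "emeasure (distr ?P (PiM I (\<lambda>i. A i \<Otimes>\<^sub>M B i)) ?z) (PiE I E) =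
      (\<Prod>i\<in>I. emeasure (A i \<Otimes>\<^sub>M B i) (E i))" .
  qed (use \<open>finite I\<close> in simp_all)
qed

section \<open>Exchangeable normal laws\<close>

text \<open>\<open>mat_inverse\<close> runs Gauss-Jordan elimination. Its computation need not be
  traced: it succeeds on units, and inverses are unique.\<close>

lemma mat_inverse_eqI:
  fixes A B :: "'a :: field mat"
  assumes A: "A \<in> carrier_mat n n" and B: "B \<in> carrier_mat n n" and AB: "A * B = 1\<^sub>m n"
  shows "mat_inverse A = Some B"
proof -
  have BA: "B * A = 1\<^sub>m n" using mat_mult_left_right_inverse[OF A B AB] .
  have "A \<in> Units (ring_mat TYPE('a) n ())"
    using A B AB BA by (auto simp: Units_def ring_mat_simps)
  then obtain C where C: "mat_inverse A = Some C"
    using mat_inverse(1)[OF A, where b = "()"] by (cases "mat_inverse A") auto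
  have C': "C * A = 1\<^sub>m n" "C \<in> carrier_mat n n" using mat_inverse(2)[OF A C] by auto
  have "C = C * (A * B)" using C' AB by simp
  also have "\<dots> = (C * A) * B" by (simp only: assoc_mult_mat[OF C'(2) A B])
  also have "\<dots> = B" using C' B by simp
  finally show ?thesis using C by simp
qed

text \<open>The matrix is (1 - \<rho>) I + \<rho> J with J the all-ones matrix, so its only possible
  eigenvalues are 1 - \<rho> and 1 + (n - 1) \<rho>, both nonzero by hypothesis. Its inverse is a
  multiple of I with a rank-one correction.\<close>

lemma mat_inverse_exchangeable:
  fixes \<rho> :: real
  assumes "\<rho> \<noteq> 1" and d: "1 + (real n - 1) * \<rho> \<noteq> 0"
  shows "mat_inverse (exchangeable_corr_mat n \<rho>) =
    Some (mat n n (\<lambda>(i, j). (if i = j then 1 / (1 - \<rho>) else 0) - \<rho> / ((1 - \<rho>) * (1 + (real n - 1) * \<rho>))))"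
    (is "_ = Some ?B")
proof (rule mat_inverse_eqI[where n = n])
  define c where "c = \<rho> / ((1 - \<rho>) * (1 + (real n - 1) * \<rho>))"
  show "exchangeable_corr_mat n \<rho> * ?B = 1\<^sub>m n"
  proof (rule eq_matI)
    fix i j assume "i < dim_row (1\<^sub>m n :: real mat)" "j < dim_col (1\<^sub>m n :: real mat)"
    then have ij: "i < n" "j < n" by auto
    have "(exchangeable_corr_mat n \<rho> * ?B) $$ (i, j) =
      (\<Sum>k<n. (if i = k then 1 else \<rho>) * ((if k = j then 1 / (1 - \<rho>) else 0) - c))"
      using ij by (simp add: exchangeable_corr_mat_def scalar_prod_def c_def atLeast0LessThan)
    \<comment> \<open>Row i of the matrix is constantly \<rho>, with an excess of 1 - \<rho> on the
      diagonal.\<close>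
    also have "\<dots> = (\<Sum>k<n. (if k = i then (1 - \<rho>) * ((if i = j then 1 / (1 - \<rho>) else 0) - c) else 0)
      + (if k = j then \<rho> / (1 - \<rho>) else 0) - \<rho> * c)"
      by (intro sum.cong) (auto simp: algebra_simps)
    also have "\<dots> = (1 - \<rho>) * ((if i = j then 1 / (1 - \<rho>) else 0) - c) + \<rho> / (1 - \<rho>) - real n * \<rho> * c"
      using ij by (simp add: sum.distrib sum_subtractf)
    also have "\<dots> = (if i = j then 1 else 0) + (\<rho> / (1 - \<rho>) - c * (1 + (real n - 1) * \<rho>))"
      using \<open>\<rho> \<noteq> 1\<close> by (auto simp: field_simps)
    \<comment> \<open>The constant \<open>c\<close> is chosen so that the bracket vanishes.\<close>
    also have "c * (1 + (real n - 1) * \<rho>) = \<rho> / (1 - \<rho>)"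
      using d by (simp add: c_def)
    finally show "(exchangeable_corr_mat n \<rho> * ?B) $$ (i, j) = 1\<^sub>m n $$ (i, j)"
      using ij by simp
  qed (auto simp: exchangeable_corr_mat_def)
qed (auto simp: exchangeable_corr_mat_def)

text \<open>The quadratic form of the inverse of \<open>(1 - \<rho>) I + \<rho> J\<close>, by the Sherman--Morrison formula.\<close>

definition exch_form :: "nat \<Rightarrow> real \<Rightarrow> (nat \<Rightarrow> real) \<Rightarrow> real" where
  "exch_form n \<rho> s = (\<Sum>i<n. (s i)\<^sup>2) / (1 - \<rho>) - \<rho> * (\<Sum>i<n. s i)\<^sup>2 / ((1 - \<rho>) * (1 + (real n - 1) * \<rho>))"

lemma borel_measurable_exch_form [measurable]: "exch_form n \<rho> \<in> borel_measurable (vec_lborel n)"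
  unfolding exch_form_def by measurable

lemma centred_normal_law_exchangeable:
  fixes \<rho> :: real
  assumes "\<rho> \<noteq> 1" and "1 + (real n - 1) * \<rho> \<noteq> 0"
  shows "centred_normal_law (exchangeable_corr_mat n \<rho>) = density (vec_lborel n)
    (\<lambda>s. ennreal (1 / sqrt ((2 * pi) ^ n * Determinant.det (exchangeable_corr_mat n \<rho>)) *
      exp (- exch_form n \<rho> s / 2)))"
proof -
  define c where "c = \<rho> / ((1 - \<rho>) * (1 + (real n - 1) * \<rho>))"
  have form: "(\<Sum>i<n. \<Sum>j<n. s i * (mat n n (\<lambda>(i, j). (if i = j then 1 / (1 - \<rho>) else 0) - c) $$ (i, j)) * s j)
    = exch_form n \<rho> s" for s :: "nat \<Rightarrow> real"
  proof -
    have "(\<Sum>i<n. \<Sum>j<n. s i * (mat n n (\<lambda>(i, j). (if i = j then 1 / (1 - \<rho>) else 0) - c) $$ (i, j)) * s j)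
      = (\<Sum>i<n. \<Sum>j<n. (if j = i then (s i)\<^sup>2 / (1 - \<rho>) else 0) - c * (s i * s j))"
      by (intro sum.cong refl) (auto simp: algebra_simps power2_eq_square)
    also have "\<dots> = (\<Sum>i<n. (s i)\<^sup>2 / (1 - \<rho>)) - c * (\<Sum>i<n. \<Sum>j<n. s i * s j)"
      by (simp add: sum_subtractf sum_distrib_left)
    also have "(\<Sum>i<n. \<Sum>j<n. s i * s j) = (\<Sum>i<n. s i)\<^sup>2"
      by (simp add: power2_eq_square sum_product)
    finally show ?thesis by (simp add: exch_form_def c_def sum_divide_distrib)
  qed
  have dim: "dim_row (exchangeable_corr_mat n \<rho>) = n" by (simp add: exchangeable_corr_mat_def)
  show ?thesis
    unfolding centred_normal_law_def Let_def mat_inverse_exchangeable[OF assms, folded c_def] option.sel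
    by (simp only: form dim times_divide_eq_left mult_1)
qed

text \<open>Total mass one fixes the constant, so that the determinant in the normal density is not needed
  for general \<open>n\<close>.\<close>

lemma density_proportional_eq:
  fixes f :: "'a \<Rightarrow> real"
  assumes [measurable]: "f \<in> borel_measurable M" and nonneg: "\<And>x. 0 \<le> f x"
    and a: "prob_space (density M (\<lambda>x. ennreal (a * f x)))"
    and b: "prob_space (density M (\<lambda>x. ennreal (b * f x)))"
  shows "density M (\<lambda>x. ennreal (a * f x)) = density M (\<lambda>x. ennreal (b * f x))"
proof -
  let ?I = "\<integral>\<^sup>+x. f x \<partial>M"
  have *: "0 < c \<and> ennreal c * ?I = 1" if "prob_space (density M (\<lambda>x. ennreal (c * f x)))" for c
  proof -
    have "emeasure (density M (\<lambda>x. ennreal (c * f x))) (space M) = 1"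
      using prob_space.emeasure_space_1[OF that] by simp
    then have int: "(\<integral>\<^sup>+x. ennreal (c * f x) \<partial>M) = 1"
      by (subst (asm) emeasure_density) (auto cong: nn_integral_cong)
    \<comment> \<open>\<open>ennreal\<close> truncates negative numbers to zero, so a nonpositive
      factor would leave no mass at all. This is where the signs of \<open>a\<close> and
      \<open>b\<close> come from.\<close>
    have "0 < c"
    proof (rule ccontr)
      assume "\<not> 0 < c"
      then have "ennreal (c * f x) = 0" for x using nonneg[of x] by (simp add: ennreal_eq_0_iff mult_nonpos_nonneg)
      then show False using int by simp
    qed
    moreover have "(\<integral>\<^sup>+x. ennreal (c * f x) \<partial>M) = ennreal c * ?I"
      using \<open>0 < c\<close> nonneg by (simp add: ennreal_mult nn_integral_cmult)
    ultimately show ?thesis using int by simp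
  qed
  have "?I \<noteq> 0" "?I \<noteq> \<infinity>" using *[OF a] by (auto simp: ennreal_mult_eq_top_iff)
  moreover have "ennreal a * ?I = ennreal b * ?I" using *[OF a] *[OF b] by simp
  ultimately have "ennreal a = ennreal b"
    by (metis ennreal_mult_divide_eq infinity_ennreal_def mult.commute)
  then have "a = b" using *[OF a] *[OF b] by (simp add: less_imp_le)
  then show ?thesis by simp
qed

text \<open>Bayes' rule for the random intercept: prior density of a times likelihood of s equals
  marginal density of s times posterior density of a. In the posterior only the mean depends on s,
  whence the order of the quantifiers.\<close>

lemma random_intercept_density_eq:
  fixes \<rho> :: real
  assumes \<rho>: "0 \<le> \<rho>" "\<rho> < 1"
  shows "\<exists>k \<tau>. 0 < \<tau> \<and> (\<forall>s. \<exists>m. \<forall>a.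
    std_normal_density a * (\<Prod>j<n. normal_density (sqrt \<rho> * a) (sqrt (1 - \<rho>)) (s j)) =
    k * exp (- exch_form n \<rho> s / 2) * normal_density m \<tau> a)"
proof -
  define d where "d = 1 + (real n - 1) * \<rho>"
  have "d = (1 - \<rho>) + real n * \<rho>" by (simp add: d_def algebra_simps)
  then have d: "0 < d" using \<rho> by (simp add: add_pos_nonneg)
  \<comment> \<open>The posterior standard deviation: the prior contributes precision 1 and each of
    the n observations \<rho> / (1 - \<rho>), in total d / (1 - \<rho>).\<close>
  define \<tau> where "\<tau> = sqrt ((1 - \<rho>) / d)"
  have \<tau>: "0 < \<tau>" "\<tau>\<^sup>2 = (1 - \<rho>) / d" using \<rho> d by (auto simp: \<tau>_def)
  \<comment> \<open>The last factor cancels the normalising constant of the posterior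
    density.\<close>
  define k where "k = 1 / sqrt (2 * pi) * (1 / sqrt (2 * pi * (1 - \<rho>))) ^ n * sqrt (2 * pi * \<tau>\<^sup>2)"
  have "std_normal_density a * (\<Prod>j<n. normal_density (sqrt \<rho> * a) (sqrt (1 - \<rho>)) (s j)) =
    k * exp (- exch_form n \<rho> s / 2) * normal_density (sqrt \<rho> * (\<Sum>j<n. s j) / d) \<tau> a" for a and s :: "nat \<Rightarrow> real"
  proof -
    define S T where "S = (\<Sum>j<n. s j)" and "T = (\<Sum>j<n. (s j)\<^sup>2)"
    have sq: "(\<Sum>j<n. (s j - sqrt \<rho> * a)\<^sup>2) = T - 2 * sqrt \<rho> * a * S + real n * \<rho> * a\<^sup>2"
      using \<rho> by (simp add: power2_diff sum.distrib sum_subtractf S_def T_def sum_distrib_left power_mult_distrib algebra_simps)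
    have "(\<Prod>j<n. normal_density (sqrt \<rho> * a) (sqrt (1 - \<rho>)) (s j)) =
      (\<Prod>j<n. 1 / sqrt (2 * pi * (1 - \<rho>)) * exp (- (s j - sqrt \<rho> * a)\<^sup>2 / (2 * (1 - \<rho>))))"
      using \<rho> by (simp add: normal_density_def)
    also have "\<dots> = (1 / sqrt (2 * pi * (1 - \<rho>))) ^ n * exp (- (\<Sum>j<n. (s j - sqrt \<rho> * a)\<^sup>2) / (2 * (1 - \<rho>)))"
      by (subst prod.distrib) (simp add: exp_sum[symmetric] sum_divide_distrib sum_negf)
    finally have prod: "(\<Prod>j<n. normal_density (sqrt \<rho> * a) (sqrt (1 - \<rho>)) (s j)) = \<dots>" .
    have expo: "- a\<^sup>2 / 2 + - (\<Sum>j<n. (s j - sqrt \<rho> * a)\<^sup>2) / (2 * (1 - \<rho>)) =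
      - exch_form n \<rho> s / 2 + - (a - sqrt \<rho> * S / d)\<^sup>2 / (2 * \<tau>\<^sup>2)"
    proof -
      \<comment> \<open>The remainder of completing the square in a; up to sign and the factor 1 -
        \<rho> it is the rank-one term of \<open>exch_form\<close>.\<close>
      define Z where "Z = \<rho> * S\<^sup>2 / d"
      have "exch_form n \<rho> s = T / (1 - \<rho>) - Z / (1 - \<rho>)"
        by (simp add: exch_form_def S_def T_def d_def Z_def)
      moreover have "(a - sqrt \<rho> * S / d)\<^sup>2 / \<tau>\<^sup>2 = (d * a\<^sup>2 - 2 * sqrt \<rho> * S * a + Z) / (1 - \<rho>)"
      proof -
        have "(a - sqrt \<rho> * S / d)\<^sup>2 = a\<^sup>2 - 2 * sqrt \<rho> * S * a / d + \<rho> * S\<^sup>2 / d\<^sup>2"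
          using \<rho> by (simp add: power2_diff power_divide power_mult_distrib algebra_simps)
        also have "\<dots> = (d * a\<^sup>2 - 2 * sqrt \<rho> * S * a + Z) / d"
          using d by (simp add: Z_def field_simps power2_eq_square)
        finally show ?thesis using d by (simp add: \<tau>)
      qed
      ultimately have "exch_form n \<rho> s + (a - sqrt \<rho> * S / d)\<^sup>2 / \<tau>\<^sup>2 =
          (T + d * a\<^sup>2 - 2 * sqrt \<rho> * S * a) / (1 - \<rho>)"
        by (simp add: diff_divide_distrib[symmetric] add_divide_distrib[symmetric] algebra_simps)
      also have "T + d * a\<^sup>2 - 2 * sqrt \<rho> * S * a =
          (1 - \<rho>) * a\<^sup>2 + (T - 2 * sqrt \<rho> * a * S + real n * \<rho> * a\<^sup>2)"
        by (simp add: d_def algebra_simps)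
      also have "\<dots> / (1 - \<rho>) = a\<^sup>2 + (T - 2 * sqrt \<rho> * a * S + real n * \<rho> * a\<^sup>2) / (1 - \<rho>)"
        using \<rho> by (simp add: add_divide_distrib)
      finally have "exch_form n \<rho> s + (a - sqrt \<rho> * S / d)\<^sup>2 / \<tau>\<^sup>2 =
          a\<^sup>2 + (\<Sum>j<n. (s j - sqrt \<rho> * a)\<^sup>2) / (1 - \<rho>)"
        unfolding sq .
      moreover have "- (w / 2) + - (z / 2) = - (x / 2) + - (y / 2)" if "x + y = w + z" for w x y z :: real
        using that by argo
      ultimately show ?thesis
        unfolding mult.commute[of 2] divide_divide_eq_left[symmetric] minus_divide_left[symmetric] by blast
    qed
    have "std_normal_density a * (\<Prod>j<n. normal_density (sqrt \<rho> * a) (sqrt (1 - \<rho>)) (s j)) =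
      1 / sqrt (2 * pi) * (1 / sqrt (2 * pi * (1 - \<rho>))) ^ n *
      exp (- a\<^sup>2 / 2 + - (\<Sum>j<n. (s j - sqrt \<rho> * a)\<^sup>2) / (2 * (1 - \<rho>)))"
      unfolding prod std_normal_density_def exp_add by simp
    also have "\<dots> = k * exp (- exch_form n \<rho> s / 2) * normal_density (sqrt \<rho> * S / d) \<tau> a"
      unfolding expo exp_add normal_density_def k_def using \<tau>(1) by simp
    finally show ?thesis by (simp add: S_def)
  qed
  then show ?thesis using \<tau>(1) by blast
qed

text \<open>Marginal times conditional density: given the first coordinate, the second is normal
  with mean \<rho> * s 0 and variance 1 - \<rho>^2. Unlike the random intercept, this factorisation
  covers negative \<rho>.\<close>

lemma bivariate_normal_density_eq:
  fixes \<rho> :: real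
  assumes "\<rho> \<in> {-1<..<1}"
  shows "std_normal_density (s 0) * normal_density (\<rho> * s 0) (sqrt (1 - \<rho>\<^sup>2)) (s 1) =
    1 / (2 * pi * sqrt (1 - \<rho>\<^sup>2)) * exp (- exch_form 2 \<rho> s / 2)"
proof -
  define r where "r = 1 - \<rho>\<^sup>2"
  have r: "0 < r" "r = (1 - \<rho>) * (1 + \<rho>)" using assms by (auto simp: r_def power2_eq_square algebra_simps abs_square_less_1[unfolded power2_eq_square])
  have "exch_form 2 \<rho> s = (s 0)\<^sup>2 + (s 1 - \<rho> * s 0)\<^sup>2 / r"
    using assms unfolding exch_form_def r(2)
    by (simp add: eval_nat_numeral lessThan_Suc divide_simps) (simp add: algebra_simps)
  then have "exp (- exch_form 2 \<rho> s / 2) = exp (- (s 0)\<^sup>2 / 2) * exp (- (s 1 - \<rho> * s 0)\<^sup>2 / (2 * r))"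
    by (simp add: exp_add[symmetric] add_divide_distrib diff_divide_distrib)
  moreover have "sqrt (2 * pi) * sqrt (2 * pi * r) = 2 * pi * sqrt r"
  proof -
    have "sqrt (2 * pi) * sqrt (2 * pi * r) = (sqrt (2 * pi) * sqrt (2 * pi)) * sqrt r"
      unfolding real_sqrt_mult[of "2 * pi" r] by (simp only: mult.assoc)
    then show ?thesis by simp
  qed
  ultimately show ?thesis
    unfolding std_normal_density_def normal_density_def r_def[symmetric] using r(1)
    by (simp add: divide_simps)
qed

section \<open>The bivariate normal copula\<close>

lemma borel_measurable_normal_density_mean [measurable (raw)]:
  assumes [measurable]: "m \<in> borel_measurable M" "f \<in> borel_measurable M"
  shows "(\<lambda>x. normal_density (m x) \<sigma> (f x)) \<in> borel_measurable M"
  unfolding normal_density_def by measurable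

text \<open>Subtracting \<rho> times the first row from the second makes the matrix triangular with
  diagonal 1, 1 - \<rho>^2.\<close>

lemma det_exchangeable_2: "Determinant.det (exchangeable_corr_mat 2 \<rho>) = 1 - \<rho>\<^sup>2"
proof -
  let ?R = "exchangeable_corr_mat 2 \<rho>" and ?L = "addrow (- \<rho>) 1 0 (exchangeable_corr_mat 2 \<rho>)"
  have "Determinant.det ?R = Determinant.det ?L"
    by (rule det_addrow[symmetric, of _ 2]) (auto simp: exchangeable_corr_mat_def)
  also have "\<dots> = prod_list (diag_mat ?L)"
    by (rule det_upper_triangular[of _ 2]) (auto simp: exchangeable_corr_mat_def upper_triangular_def less_2_cases_iff)
  also have "\<dots> = 1 - \<rho>\<^sup>2"
    by (simp add: diag_mat_def exchangeable_corr_mat_def upt_rec power2_eq_square)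
  finally show ?thesis .
qed

lemma centred_normal_law_exchangeable_2:
  assumes "\<rho> \<in> {-1<..<1}"
  shows "centred_normal_law (exchangeable_corr_mat 2 \<rho>) = density (vec_lborel 2)
    (\<lambda>s. ennreal (std_normal_density (s 0) * normal_density (\<rho> * s 0) (sqrt (1 - \<rho>\<^sup>2)) (s 1)))"
proof -
  have "sqrt ((2 * pi)\<^sup>2 * (1 - \<rho>\<^sup>2)) = 2 * pi * sqrt (1 - \<rho>\<^sup>2)"
    by (simp add: real_sqrt_mult)
  moreover have "1 + (real 2 - 1) * \<rho> \<noteq> 0" using assms by auto
  ultimately show ?thesis
    using assms by (simp only: bivariate_normal_density_eq[OF assms] det_exchangeable_2
        centred_normal_law_exchangeable[of \<rho> 2]) (simp add: centred_normal_law_exchangeable det_exchangeable_2)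
qed

lemma distr_std_normal_affine:
  assumes "0 < \<sigma>"
  shows "distr std_normal_distribution borel (\<lambda>b. m + \<sigma> * b) = density lborel (normal_density m \<sigma>)"
proof -
  interpret N: real_distribution std_normal_distribution by (rule real_dist_normal_dist)
  have "distributed std_normal_distribution lborel (\<lambda>x. x) std_normal_density"
    by (auto simp: distributed_def distr_id2 intro!: measure_eqI)
  from N.normal_density_affine[OF this _ , of \<sigma> m] assms
  have "distr std_normal_distribution lborel (\<lambda>b. m + \<sigma> * b) = density lborel (normal_density m \<sigma>)"
    by (simp add: distributed_def)
  moreover have "distr std_normal_distribution lborel (\<lambda>b. m + \<sigma> * b) = distr std_normal_distribution borel (\<lambda>b. m + \<sigma> * b)"
    by (intro distr_cong) auto
  ultimately show ?thesis by simp
qed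

abbreviation N01 :: "real measure" where
  "N01 \<equiv> std_normal_distribution"

lemma prob_space_N01: "prob_space N01"
  using real_dist_normal_dist by (simp add: real_distribution_def)

text \<open>The Cholesky representation of a correlated normal pair. The joint density splits into
  the marginal of a and the conditional law of the second coordinate, and the latter is an affine
  image of N(0, 1).\<close>

lemma distr_centred_normal_law_2:
  assumes \<rho>: "\<rho> \<in> {-1<..<1}"
  shows "distr (centred_normal_law (exchangeable_corr_mat 2 \<rho>)) (borel \<Otimes>\<^sub>M borel) (\<lambda>s. (s 0, s 1)) =
    distr (N01 \<Otimes>\<^sub>M N01) (borel \<Otimes>\<^sub>M borel) (\<lambda>(a, b). (a, \<rho> * a + sqrt (1 - \<rho>\<^sup>2) * b))"
proof (rule measure_eqI)
  define r where "r = sqrt (1 - \<rho>\<^sup>2)"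
  have r: "0 < r" using \<rho> by (auto simp: r_def abs_square_less_1)
  interpret L: product_sigma_finite "\<lambda>_::nat. lborel :: real measure"
    by (simp add: product_sigma_finite_def sigma_finite_lborel)
  interpret N: real_distribution N01 by (rule real_dist_normal_dist)
  fix S assume "S \<in> sets (distr (centred_normal_law (exchangeable_corr_mat 2 \<rho>)) (borel \<Otimes>\<^sub>M borel) (\<lambda>s. (s 0, s 1)))"
  then have S[measurable]: "S \<in> sets (borel \<Otimes>\<^sub>M borel)" by simp
  have two: "{..<2} = {0, 1::nat}" by auto
  let ?d = "\<lambda>a b. ennreal (std_normal_density a * normal_density (\<rho> * a) r b)"
  have "emeasure (distr (centred_normal_law (exchangeable_corr_mat 2 \<rho>)) (borel \<Otimes>\<^sub>M borel) (\<lambda>s. (s 0, s 1))) S =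
    (\<integral>\<^sup>+p. indicator S p \<partial>distr (centred_normal_law (exchangeable_corr_mat 2 \<rho>)) (borel \<Otimes>\<^sub>M borel) (\<lambda>s. (s 0, s 1)))"
    by simp
  also have "\<dots> = (\<integral>\<^sup>+s. indicator S (s 0, s 1) \<partial>centred_normal_law (exchangeable_corr_mat 2 \<rho>))"
    unfolding centred_normal_law_exchangeable_2[OF \<rho>] two
    by (rule nn_integral_distr) measurable
  also have "\<dots> = (\<integral>\<^sup>+s. ?d (s 0) (s 1) * indicator S (s 0, s 1) \<partial>PiM {0, 1::nat} (\<lambda>_. lborel))"
    unfolding centred_normal_law_exchangeable_2[OF \<rho>] r_def[symmetric] two
    by (rule nn_integral_density) measurable
  also have "\<dots> = (\<integral>\<^sup>+z. ?d (fst z) (snd z) * indicator S (fst z, snd z) \<partial>(lborel \<Otimes>\<^sub>M lborel))"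
    by (subst L.product_nn_integral_pair[of "\<lambda>a b. ?d a b * indicator S (a, b)" 0 1]) auto
  also have "\<dots> = (\<integral>\<^sup>+a. \<integral>\<^sup>+b. ?d a b * indicator S (a, b) \<partial>lborel \<partial>lborel)"
    by (subst lborel.nn_integral_fst[symmetric]) auto
  also have "\<dots> = (\<integral>\<^sup>+a. ennreal (std_normal_density a) * (\<integral>\<^sup>+b. ennreal (normal_density (\<rho> * a) r b) * indicator S (a, b) \<partial>lborel) \<partial>lborel)"
    by (intro nn_integral_cong) (simp add: ennreal_mult mult.assoc nn_integral_cmult)
  also have "\<dots> = (\<integral>\<^sup>+a. ennreal (std_normal_density a) * (\<integral>\<^sup>+b. indicator S (a, \<rho> * a + r * b) \<partial>N01) \<partial>lborel)"
  proof (intro nn_integral_cong arg_cong2[where f = "(*)"] refl)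
    fix a :: real
    have "(\<integral>\<^sup>+b. ennreal (normal_density (\<rho> * a) r b) * indicator S (a, b) \<partial>lborel) =
      (\<integral>\<^sup>+b. indicator S (a, b) \<partial>density lborel (normal_density (\<rho> * a) r))"
      by (subst nn_integral_density) auto
    also have "\<dots> = (\<integral>\<^sup>+b. indicator S (a, \<rho> * a + r * b) \<partial>N01)"
      unfolding distr_std_normal_affine[OF r, symmetric] by (subst nn_integral_distr) auto
    finally show "(\<integral>\<^sup>+b. ennreal (normal_density (\<rho> * a) r b) * indicator S (a, b) \<partial>lborel) =
      (\<integral>\<^sup>+b. indicator S (a, \<rho> * a + r * b) \<partial>N01)" .
  qed
  also have "\<dots> = (\<integral>\<^sup>+a. \<integral>\<^sup>+b. indicator S (a, \<rho> * a + r * b) \<partial>N01 \<partial>N01)"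
    by (rule nn_integral_density[symmetric]) measurable
  also have "\<dots> = (\<integral>\<^sup>+z. indicator S ((\<lambda>(a, b). (a, \<rho> * a + r * b)) z) \<partial>(N01 \<Otimes>\<^sub>M N01))"
    by (subst N.nn_integral_fst[symmetric]) auto
  also have "\<dots> = (\<integral>\<^sup>+z. indicator S z \<partial>distr (N01 \<Otimes>\<^sub>M N01) (borel \<Otimes>\<^sub>M borel) (\<lambda>(a, b). (a, \<rho> * a + r * b)))"
    by (rule nn_integral_distr[symmetric]) auto
  finally show "emeasure (distr (centred_normal_law (exchangeable_corr_mat 2 \<rho>)) (borel \<Otimes>\<^sub>M borel) (\<lambda>s. (s 0, s 1))) S =
    emeasure (distr (N01 \<Otimes>\<^sub>M N01) (borel \<Otimes>\<^sub>M borel) (\<lambda>(a, b). (a, \<rho> * a + sqrt (1 - \<rho>\<^sup>2) * b))) S"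
    by (simp add: r_def)
qed simp

text \<open>The h-function of the normal copula, the probability of V \<le> v given U = u. The
  arguments come in the order u, v, whereas \<open>cond_cdf_2_1\<close> takes v first.\<close>

definition normal_cond_cdf :: "real \<Rightarrow> real \<Rightarrow> real \<Rightarrow> real" where
  "normal_cond_cdf \<rho> u v = \<Phi> ((std_normal_quantile v - \<rho> * std_normal_quantile u) / sqrt (1 - \<rho>\<^sup>2))"

text \<open>The inverse of \<open>normal_cond_cdf \<rho> u\<close> on the open unit interval.\<close>

definition normal_cond_quantile :: "real \<Rightarrow> real \<Rightarrow> real \<Rightarrow> real" where
  "normal_cond_quantile \<rho> u w = \<Phi> (\<rho> * std_normal_quantile u + sqrt (1 - \<rho>\<^sup>2) * std_normal_quantile w)"

lemma measurable_normal_cond_cdf [measurable]: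
  "(\<lambda>(u, v). normal_cond_cdf \<rho> u v) \<in> borel_measurable (borel \<Otimes>\<^sub>M borel)"
  unfolding normal_cond_cdf_def by measurable

lemma measurable_normal_cond_quantile [measurable]:
  "(\<lambda>(u, w). normal_cond_quantile \<rho> u w) \<in> borel_measurable (borel \<Otimes>\<^sub>M borel)"
  unfolding normal_cond_quantile_def by measurable

text \<open>The copula is encoded by its sampling scheme, the inverse Rosenblatt transform: draw u
  and an independent rank w uniformly, then take the conditional quantile at w as the second
  coordinate.\<close>

definition bivariate_normal_copula_law :: "real \<Rightarrow> (real \<times> real) measure" where
  "bivariate_normal_copula_law \<rho> = distr (uniform01 \<Otimes>\<^sub>M uniform01) (borel \<Otimes>\<^sub>M borel)
     (\<lambda>(u, w). (u, normal_cond_quantile \<rho> u w))"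

text \<open>Both sides are the probability that \<Phi> a \<le> u and \<Phi> (\<rho> * a + sqrt (1 -
  \<rho>^2) * b) \<le> v for independent standard normal a and b: once by the Cholesky
  representation, once by the probability integral transform in each coordinate.\<close>

lemma bivariate_normal_copula_eq:
  assumes \<rho>: "\<rho> \<in> {-1<..<1}"
  shows "bivariate_normal_copula \<rho> u v = measure (bivariate_normal_copula_law \<rho>) ({..u} \<times> {..v})"
proof -
  let ?C = "centred_normal_law (exchangeable_corr_mat 2 \<rho>)"
  have dim: "dim_row (exchangeable_corr_mat 2 \<rho>) = 2" by (simp add: exchangeable_corr_mat_def)
  have C: "sets ?C = sets (vec_borel 2)"
    unfolding centred_normal_law_exchangeable_2[OF \<rho>] by (simp cong: sets_PiM_cong)
  note [measurable_cong] = C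
  have uv[measurable]: "{..u} \<times> {..v} \<in> sets (borel \<Otimes>\<^sub>M borel)" by auto
  have m: "(\<lambda>s. \<lambda>j\<in>{..<2}. \<Phi> (s j)) \<in> measurable ?C (vec_borel 2)"
    by measurable
  have m': "{w \<in> space (vec_borel 2). w 0 \<le> u \<and> w 1 \<le> v} \<in> sets (vec_borel 2)"
    by measurable
  have "{p \<in> space (borel \<Otimes>\<^sub>M borel). \<Phi> (fst p) \<le> u \<and> \<Phi> (snd p) \<le> v} \<in> sets (borel \<Otimes>\<^sub>M borel)"
    by measurable
  then have [measurable]: "{p. \<Phi> (fst p) \<le> u \<and> \<Phi> (snd p) \<le> v} \<in> sets (borel \<Otimes>\<^sub>M borel)"
    by (simp add: space_pair_measure)
  have "{p \<in> space (borel \<Otimes>\<^sub>M borel). fst p \<le> u \<and> normal_cond_quantile \<rho> (fst p) (snd p) \<le> v}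
      \<in> sets (borel \<Otimes>\<^sub>M borel)"
    by measurable
  then have ncq[measurable]: "{p. fst p \<le> u \<and> normal_cond_quantile \<rho> (fst p) (snd p) \<le> v} \<in> sets (borel \<Otimes>\<^sub>M borel)"
    by (simp add: space_pair_measure)
  have "bivariate_normal_copula \<rho> u v = measure ?C {s \<in> space ?C. \<Phi> (s 0) \<le> u \<and> \<Phi> (s 1) \<le> v}"
    unfolding bivariate_normal_copula_def normal_copula_def Let_def dim
    using m' by (simp add: measure_distr[OF m])
      (auto intro!: arg_cong[where f = "measure _"] simp: space_PiM)
  also have "\<dots> = measure (distr ?C (borel \<Otimes>\<^sub>M borel) (\<lambda>s. (s 0, s 1))) {p. \<Phi> (fst p) \<le> u \<and> \<Phi> (snd p) \<le> v}"
    by (subst measure_distr) (auto intro!: arg_cong[where f = "measure _"])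
  also have "\<dots> = measure (N01 \<Otimes>\<^sub>M N01) {p. \<Phi> (fst p) \<le> u \<and> \<Phi> (\<rho> * fst p + sqrt (1 - \<rho>\<^sup>2) * snd p) \<le> v}"
    unfolding distr_centred_normal_law_2[OF \<rho>]
    by (subst measure_distr) (auto intro!: arg_cong[where f = "measure _"] simp: space_pair_measure)
  also have "\<dots> = measure (distr (N01 \<Otimes>\<^sub>M N01) (borel \<Otimes>\<^sub>M borel) (\<lambda>(a, b). (\<Phi> a, \<Phi> b)))
      {p. fst p \<le> u \<and> normal_cond_quantile \<rho> (fst p) (snd p) \<le> v}"
    by (subst measure_distr)
      (use ncq in \<open>auto intro!: arg_cong[where f = "measure _"] simp: space_pair_measure normal_cond_quantile_def\<close>)
  also have "distr (N01 \<Otimes>\<^sub>M N01) (borel \<Otimes>\<^sub>M borel) (\<lambda>(a, b). (\<Phi> a, \<Phi> b)) = uniform01 \<Otimes>\<^sub>M uniform01"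
    using prob_space_uniform01
    by (simp add: pair_measure_distr[symmetric] distr_std_normal_Phi prob_space_imp_sigma_finite)
  also have "measure (uniform01 \<Otimes>\<^sub>M uniform01) {p. fst p \<le> u \<and> normal_cond_quantile \<rho> (fst p) (snd p) \<le> v} =
    measure (bivariate_normal_copula_law \<rho>) ({..u} \<times> {..v})"
    unfolding bivariate_normal_copula_law_def
    by (subst measure_distr) (auto intro!: arg_cong[where f = "measure _"] simp: space_pair_measure)
  finally show ?thesis .
qed

lemma normal_cond_cdf_in_unit: "normal_cond_cdf \<rho> u v \<in> {0<..<1}"
  unfolding normal_cond_cdf_def by simp

lemma sqrt_one_minus_square_pos: "\<rho> \<in> {-1<..<1} \<Longrightarrow> 0 < sqrt (1 - \<rho>\<^sup>2 :: real)"
  by (auto simp: abs_square_less_1)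

lemma normal_cond_cdf_quantile:
  assumes "\<rho> \<in> {-1<..<1}" "w \<in> {0<..<1}"
  shows "normal_cond_cdf \<rho> u (normal_cond_quantile \<rho> u w) = w"
  using sqrt_one_minus_square_pos[OF assms(1)] assms(2)
  by (simp add: normal_cond_cdf_def normal_cond_quantile_def)

text \<open>Turns a bound on the second copula coordinate into a half-line for the uniform rank w,
  so that its conditional probability can be read off from the uniform cdf.\<close>

lemma normal_cond_quantile_le_iff:
  assumes "\<rho> \<in> {-1<..<1}" "v \<in> {0<..<1}" "w \<in> {0<..<1}"
  shows "normal_cond_quantile \<rho> u w \<le> v \<longleftrightarrow> w \<le> normal_cond_cdf \<rho> u v"
proof -
  have "normal_cond_quantile \<rho> u w \<le> v \<longleftrightarrow> \<rho> * std_normal_quantile u + sqrt (1 - \<rho>\<^sup>2) * std_normal_quantile w \<le> std_normal_quantile v"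
    unfolding normal_cond_quantile_def using assms(2) by (rule Phi_le_iff_quantile)
  also have "\<dots> \<longleftrightarrow> std_normal_quantile w \<le> (std_normal_quantile v - \<rho> * std_normal_quantile u) / sqrt (1 - \<rho>\<^sup>2)"
    using sqrt_one_minus_square_pos[OF assms(1)] by (simp add: pos_le_divide_eq algebra_simps)
  also have "\<dots> \<longleftrightarrow> w \<le> normal_cond_cdf \<rho> u v"
    unfolding normal_cond_cdf_def using assms(3) by (rule quantile_le_iff)
  finally show ?thesis .
qed

lemma AE_uniform01_pair:
  "AE p in uniform01 \<Otimes>\<^sub>M uniform01. fst p \<in> {0<..<1} \<and> snd p \<in> {0<..<1}"
proof -
  interpret U: prob_space uniform01 by (rule prob_space_uniform01)
  interpret UU: pair_prob_space uniform01 uniform01 ..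
  show ?thesis
  proof (rule UU.AE_pair_measure)
    show "AE x in uniform01. AE y in uniform01. fst (x, y) \<in> {0<..<1} \<and> snd (x, y) \<in> {0<..<1::real}"
      using AE_uniform01
    proof eventually_elim
      case (elim x)
      show ?case using AE_uniform01 by eventually_elim (use elim in simp)
    qed
  qed measurable
qed

text \<open>The Rosenblatt transform: for almost every rank, \<open>normal_cond_cdf\<close> undoes
  \<open>normal_cond_quantile\<close>, which gives back the uniform pair from which the copula was
  built.\<close>

lemma distr_bivariate_normal_copula_law:
  assumes \<rho>: "\<rho> \<in> {-1<..<1}"
  shows "distr (bivariate_normal_copula_law \<rho>) (borel \<Otimes>\<^sub>M borel) (\<lambda>(u, v). (u, normal_cond_cdf \<rho> u v)) =
    uniform01 \<Otimes>\<^sub>M uniform01"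
proof -
  interpret U: prob_space uniform01 by (rule prob_space_uniform01)
  interpret UU: pair_prob_space uniform01 uniform01 ..
  have ae: "AE p in uniform01 \<Otimes>\<^sub>M uniform01. (fst p, normal_cond_cdf \<rho> (fst p) (normal_cond_quantile \<rho> (fst p) (snd p))) = p"
    using AE_uniform01_pair
    by eventually_elim (simp add: normal_cond_cdf_quantile[OF \<rho>])
  have "distr (bivariate_normal_copula_law \<rho>) (borel \<Otimes>\<^sub>M borel) (\<lambda>(u, v). (u, normal_cond_cdf \<rho> u v)) =
    distr (uniform01 \<Otimes>\<^sub>M uniform01) (borel \<Otimes>\<^sub>M borel) (\<lambda>p. (fst p, normal_cond_cdf \<rho> (fst p) (normal_cond_quantile \<rho> (fst p) (snd p))))"
    unfolding bivariate_normal_copula_law_def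
    by (subst distr_distr) (auto simp: comp_def case_prod_beta')
  also have "\<dots> = distr (uniform01 \<Otimes>\<^sub>M uniform01) (borel \<Otimes>\<^sub>M borel) (\<lambda>p. p)"
    by (intro distr_cong_AE ae) auto
  also have "\<dots> = uniform01 \<Otimes>\<^sub>M uniform01"
    by (intro distr_id2) (auto cong: sets_pair_measure_cong)
  finally show ?thesis .
qed

text \<open>Lower-left quadrants form an intersection-stable generator, and \<open>C2\<close>
  prescribes their masses for corners in the closed unit square. Other corners reduce to these
  because both laws are concentrated on the open square.\<close>

lemma bivariate_copula_law_eq_normal:
  assumes C: "bivariate_copula C2 c2" and \<rho>: "\<rho> \<in> {-1<..<1}"
    and eq: "\<forall>u\<in>{0..1}. \<forall>v\<in>{0..1}. C2 u v = bivariate_normal_copula \<rho> u v"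
  shows "bivariate_copula_law c2 = bivariate_normal_copula_law \<rho>"
proof -
  let ?Q = "bivariate_copula_law c2" and ?B = "bivariate_normal_copula_law \<rho>"
  interpret Q: prob_space ?Q using C by (simp add: bivariate_copula_def)
  interpret U: prob_space uniform01 by (rule prob_space_uniform01)
  interpret UU: pair_prob_space uniform01 uniform01 ..
  interpret B: prob_space ?B
    unfolding bivariate_normal_copula_law_def by (rule UU.prob_space_distr) simp
  have sets[simp]: "sets ?Q = sets (borel \<Otimes>\<^sub>M borel)" "sets ?B = sets (borel \<Otimes>\<^sub>M borel)"
    unfolding bivariate_copula_law_def bivariate_normal_copula_law_def
    by (simp_all cong: sets_pair_measure_cong)
  note [measurable_cong] = sets
  have space[simp]: "space ?Q = UNIV" "space ?B = UNIV"
    using sets_eq_imp_space_eq[OF sets(1)] sets_eq_imp_space_eq[OF sets(2)] by (auto simp: space_pair_measure)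
  have AE_Q: "AE p in ?Q. fst p \<in> {0<..<1} \<and> snd p \<in> {0<..<1}"
  proof -
    have [measurable]: "(\<lambda>(u, v). ennreal (c2 u v)) \<in> borel_measurable (uniform01 \<Otimes>\<^sub>M uniform01)"
    proof -
      have "case_prod c2 \<in> borel_measurable (uniform01 \<Otimes>\<^sub>M uniform01)"
        using C by (simp add: bivariate_copula_def cong: measurable_cong_sets sets_pair_measure_cong)
      from measurable_compose[OF this measurable_ennreal] show ?thesis
        by (simp add: case_prod_beta')
    qed
    show ?thesis
      unfolding bivariate_copula_law_def
    proof (subst AE_density)
      show "AE p in uniform01 \<Otimes>\<^sub>M uniform01. 0 < (case p of (u, v) \<Rightarrow> ennreal (c2 u v)) \<longrightarrow>
          fst p \<in> {0<..<1} \<and> snd p \<in> {0<..<1}"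
        using AE_uniform01_pair by eventually_elim blast
    qed measurable
  qed
  have AE_B: "AE p in ?B. fst p \<in> {0<..<1} \<and> snd p \<in> {0<..<1}"
    unfolding bivariate_normal_copula_law_def
  proof (subst AE_distr_iff)
    show "AE p in uniform01 \<Otimes>\<^sub>M uniform01. fst (case p of (u, w) \<Rightarrow> (u, normal_cond_quantile \<rho> u w)) \<in> {0<..<1} \<and>
        snd (case p of (u, w) \<Rightarrow> (u, normal_cond_quantile \<rho> u w)) \<in> {0<..<1}"
      using AE_uniform01_pair by eventually_elim (auto simp: normal_cond_quantile_def)
  qed measurable
  have meas[measurable]: "{..a} \<times> {..b} \<in> sets (borel \<Otimes>\<^sub>M borel)" for a b :: real
    by simp
  have *: "measure ?Q ({..a} \<times> {..b}) = measure ?B ({..a} \<times> {..b})" for a b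
  proof (cases "a < 0 \<or> b < 0")
    case True
    have "emeasure ?Q ({..a} \<times> {..b}) = 0"
    proof -
      have "AE p in ?Q. p \<notin> {..a} \<times> {..b}" using AE_Q by eventually_elim (use True in auto)
      from emeasure_eq_0_AE[OF this] show ?thesis by simp
    qed
    moreover have "emeasure ?B ({..a} \<times> {..b}) = 0"
    proof -
      have "AE p in ?B. p \<notin> {..a} \<times> {..b}" using AE_B by eventually_elim (use True in auto)
      from emeasure_eq_0_AE[OF this] show ?thesis by simp
    qed
    ultimately show ?thesis by (simp add: measure_def)
  next
    case False
    \<comment> \<open>A corner coordinate above 1 may be lowered to 1 without changing the mass,
      since almost all points lie below 1 in each coordinate.\<close>
    define a' b' where "a' = min a 1" and "b' = min b 1"
    have ab: "a' \<in> {0..1}" "b' \<in> {0..1}" using False by (auto simp: a'_def b'_def)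
    have "measure ?Q ({..a} \<times> {..b}) = measure ?Q ({..a'} \<times> {..b'})"
    proof (rule Q.finite_measure_eq_AE)
      show "AE p in ?Q. p \<in> {..a} \<times> {..b} \<longleftrightarrow> p \<in> {..a'} \<times> {..b'}"
        using AE_Q by eventually_elim (auto simp: a'_def b'_def)
    qed simp_all
    also have "\<dots> = C2 a' b'"
      using C ab by (simp add: bivariate_copula_def)
    also have "\<dots> = measure ?B ({..a'} \<times> {..b'})"
      using eq ab by (simp add: bivariate_normal_copula_eq[OF \<rho>])
    also have "\<dots> = measure ?B ({..a} \<times> {..b})"
    proof (rule B.finite_measure_eq_AE)
      show "AE p in ?B. p \<in> {..a'} \<times> {..b'} \<longleftrightarrow> p \<in> {..a} \<times> {..b}"
        using AE_B by eventually_elim (auto simp: a'_def b'_def)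
    qed simp_all
    finally show ?thesis .
  qed
  \<comment> \<open>The order on pairs is componentwise, so its principal down-sets are exactly the
    quadrants.\<close>
  have atMost: "{..p} = {..fst p} \<times> {..snd p}" for p :: "real \<times> real"
    by (auto simp: less_eq_prod_def)
  have gen: "sets (borel :: (real \<times> real) measure) = sigma_sets UNIV (range (\<lambda>p. {..p}))"
    by (subst borel_eq_atMost) (rule sets_measure_of, simp)
  show ?thesis
  proof (rule measure_eqI_generator_eq[where E = "range (\<lambda>p::real \<times> real. {..p})" and \<Omega> = UNIV and A = "\<lambda>i. {..(real i, real i)}"])
    show "Int_stable (range (\<lambda>p::real \<times> real. {..p}))"
    proof (rule Int_stableI)
      fix a b assume "a \<in> range (\<lambda>p::real \<times> real. {..p})" "b \<in> range (\<lambda>p::real \<times> real. {..p})"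
      then obtain p q where pq: "a = {..p}" "b = {..q}" by blast
      have "{..p} \<inter> {..q} = {..inf p q}" by (simp add: set_eq_iff)
      then show "a \<inter> b \<in> range (\<lambda>p::real \<times> real. {..p})" unfolding pq by blast
    qed
    show "sets ?Q = sigma_sets UNIV (range (\<lambda>p::real \<times> real. {..p}))" 
      "sets ?B = sigma_sets UNIV (range (\<lambda>p::real \<times> real. {..p}))"
      unfolding sets borel_prod by (fact gen)+
    show "emeasure ?Q X = emeasure ?B X" if "X \<in> range (\<lambda>p::real \<times> real. {..p})" for X
    proof -
      from that obtain p where "X = {..fst p} \<times> {..snd p}" unfolding atMost by blast
      then show ?thesis using * by (simp only: Q.emeasure_eq_measure B.emeasure_eq_measure)
    qed
    show "(\<Union>i. {..(real i, real i)}) = UNIV"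
    proof -
      have "\<exists>i. p \<le> (real i, real i)" for p :: "real \<times> real"
        using real_arch_simple[of "max (fst p) (snd p)"] by (auto simp only: less_eq_prod_def fst_conv snd_conv max.bounded_iff)
      then show ?thesis by blast
    qed
    show "range (\<lambda>i. {..(real i, real i)}) \<subseteq> range (\<lambda>p::real \<times> real. {..p})" by fast
    show "emeasure ?Q {..(real i, real i)} \<noteq> \<infinity>" for i by simp
  qed simp
qed

text \<open>Conditioning on the first coordinate writes C2 t v as the integral of
  \<open>normal_cond_cdf \<rho> s v\<close> over s from 0 to t. The integrand is continuous on the
  open unit interval, so the fundamental theorem of calculus gives the derivative at every interior
  point.\<close>

lemma cond_cdf_bivariate_normal_copula:
  assumes \<rho>: "\<rho> \<in> {-1<..<1}" and u: "u \<in> {0<..<1}" and v: "v \<in> {0<..<1}"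
    and eq: "\<forall>u\<in>{0..1}. \<forall>v\<in>{0..1}. C2 u v = bivariate_normal_copula \<rho> u v"
  shows "cond_cdf_2_1 C2 v u = normal_cond_cdf \<rho> u v"
proof -
  interpret U: prob_space uniform01 by (rule prob_space_uniform01)
  interpret UU: pair_prob_space uniform01 uniform01 ..
  interpret B: prob_space "bivariate_normal_copula_law \<rho>"
    unfolding bivariate_normal_copula_law_def by (rule UU.prob_space_distr) simp
  \<comment> \<open>\<open>C2 t v\<close> is the integral of \<open>f\<close> over \<open>{0..t}\<close>; the values of \<open>std_normal_quantile\<close>
    outside the open unit interval are junk and are cut off.\<close>
  define f where "f t = indicator {0<..<1} t * normal_cond_cdf \<rho> t v" for t
  have [measurable]: "f \<in> borel_measurable borel" unfolding f_def by measurable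
  have f_nonneg: "0 \<le> f t" for t using normal_cond_cdf_in_unit[of \<rho> t v] by (simp add: f_def indicator_def)
  have C: "(f has_integral C2 t v) {0..t}" if t: "t \<in> {0..1}" for t
  proof -
    have [measurable]: "{p \<in> space (uniform01 \<Otimes>\<^sub>M uniform01). fst p \<le> t \<and> normal_cond_quantile \<rho> (fst p) (snd p) \<le> v}
        \<in> sets (uniform01 \<Otimes>\<^sub>M uniform01)" (is "?S \<in> _") by measurable
    have "ennreal (C2 t v) = emeasure (bivariate_normal_copula_law \<rho>) ({..t} \<times> {..v})"
      using t v eq by (simp add: bivariate_normal_copula_eq[OF \<rho>] B.emeasure_eq_measure)
    also have "\<dots> = emeasure (uniform01 \<Otimes>\<^sub>M uniform01) ?S"
      unfolding bivariate_normal_copula_law_def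
      by (subst emeasure_distr) (auto intro!: arg_cong[where f = "emeasure _"] simp: space_pair_measure)
    also have "\<dots> = (\<integral>\<^sup>+s. emeasure uniform01 (Pair s -` ?S) \<partial>uniform01)"
      by (rule U.emeasure_pair_measure_alt) measurable
    also have "\<dots> = (\<integral>\<^sup>+s. indicator {..t} s * ennreal (normal_cond_cdf \<rho> s v) \<partial>uniform01)"
    proof (rule nn_integral_cong)
      fix s
      \<comment> \<open>The section at s is a half-line in the rank w only up to a null set: the
        equivalence behind it is available for w in the open unit interval.\<close>
      have "emeasure uniform01 (Pair s -` ?S) = emeasure uniform01 (if s \<le> t then {..normal_cond_cdf \<rho> s v} else {})"
      proof (rule emeasure_eq_AE)
        show "AE w in uniform01. w \<in> Pair s -` ?S \<longleftrightarrow>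
            w \<in> (if s \<le> t then {..normal_cond_cdf \<rho> s v} else {})"
          using AE_uniform01
          by eventually_elim (simp add: space_pair_measure normal_cond_quantile_le_iff[OF \<rho> v])
      qed (auto intro: sets_Pair1)
      also have "\<dots> = indicator {..t} s * ennreal (normal_cond_cdf \<rho> s v)"
        using normal_cond_cdf_in_unit[of \<rho> s v] cdf_uniform01[of "normal_cond_cdf \<rho> s v"]
        by (simp add: cdf_def U.emeasure_eq_measure)
      finally show "emeasure uniform01 (Pair s -` ?S) = indicator {..t} s * ennreal (normal_cond_cdf \<rho> s v)" .
    qed
    also have "\<dots> = (\<integral>\<^sup>+s. ennreal (indicator {0..t} s * f s) \<partial>lborel)"
      unfolding uniform01_eq_density
      by (subst nn_integral_density) (auto simp: f_def indicator_def intro!: nn_integral_cong)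
    finally have "((\<lambda>s. indicator {0..t} s * f s) has_integral C2 t v) UNIV"
      using f_nonneg eq t v
      by (intro nn_integral_has_integral) (auto simp: bivariate_normal_copula_eq[OF \<rho>])
    moreover have "(\<lambda>s. indicator {0..t} s * f s) = (\<lambda>s. if s \<in> {0..t} then f s else 0)"
      by (auto simp: indicator_def)
    ultimately show ?thesis by (simp only: has_integral_restrict_UNIV)
  qed
  have cont: "isCont f u"
  proof -
    have "continuous_on {0<..<1} (\<lambda>t. normal_cond_cdf \<rho> t v)"
      unfolding normal_cond_cdf_def
      using sqrt_one_minus_square_pos[OF \<rho>]
      by (intro continuous_on_compose2[OF continuous_on_Phi[of UNIV]] continuous_intros continuous_on_quantile) auto
    then have "continuous_on {0<..<1} f"
      by (rule continuous_on_eq) (auto simp: f_def)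
    then show ?thesis using u by (simp add: continuous_on_eq_continuous_at)
  qed
  have "f integrable_on {0..1}" using has_integral_integrable[OF C[of 1]] by simp
  moreover have "continuous (at u within ({0..1} - {})) f"
    using cont by (rule continuous_at_imp_continuous_at_within)
  ultimately have "((\<lambda>t. integral {0..t} f) has_vector_derivative f u) (at u within ({0..1} - {}))"
    using u by (intro integral_has_vector_derivative_continuous_at) simp_all
  then have "((\<lambda>t. integral {0..t} f) has_real_derivative f u) (at u)"
    using u at_within_interior[of u "{0..1}"]
    by (simp add: has_real_derivative_iff_has_vector_derivative)
  \<comment> \<open>A derivative depends only on values near u, and the integral formula for
    \<open>C2\<close> holds on the neighbourhood (0, 1) of u.\<close>
  moreover have ev: "eventually (\<lambda>t. integral {0..t} f = C2 t v) (nhds u)"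
  proof -
    have "eventually (\<lambda>t. t \<in> {0<..<1}) (nhds u)"
      using u by (intro eventually_nhds_in_open) auto
    then show ?thesis by eventually_elim (auto intro!: integral_unique C)
  qed
  ultimately have "((\<lambda>t. C2 t v) has_real_derivative f u) (at u)"
    using DERIV_cong_ev[OF refl ev refl] by simp
  then show ?thesis
    unfolding cond_cdf_2_1_def using u by (simp add: DERIV_imp_deriv f_def)
qed

section \<open>The joint law of the covariates and the conditional ranks\<close>

lemma prob_space_uniform_PiM: "prob_space (PiM I (\<lambda>_. uniform01))"
  by (intro prob_space_PiM prob_space_uniform01)

lemma sets_PiM_uniform01 [simp, measurable_cong]: "sets (PiM I (\<lambda>_. uniform01)) = sets (PiM I (\<lambda>_. borel))"
  by (rule sets_PiM_cong) auto

lemma space_PiM_uniform01 [simp]: "space (PiM I (\<lambda>_. uniform01)) = space (PiM I (\<lambda>_. borel))"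
  by (rule sets_eq_imp_space_eq) simp

text \<open>The product of the \<open>c2\<close> factors turns the uniform law on n pairs into the
  n-th power of the copula law; the coordinatewise Rosenblatt transform leads back to the uniform
  law, under which f and g separate. The test functions are arbitrary so that the densities c1 and
  c3 can be absorbed into them.\<close>

lemma nn_integral_bivariate_normal_copula_product:
  fixes f g :: "(nat \<Rightarrow> real) \<Rightarrow> ennreal"
  assumes \<rho>: "\<rho> \<in> {-1<..<1}"
    and C: "bivariate_copula_law c2 = bivariate_normal_copula_law \<rho>"
    and c2: "case_prod c2 \<in> borel_measurable (borel \<Otimes>\<^sub>M borel)"
    and f [measurable]: "f \<in> borel_measurable (vec_borel n)"
    and g [measurable]: "g \<in> borel_measurable (vec_borel n)"
  shows "(\<integral>\<^sup>+p. f (fst p) * g (\<lambda>j\<in>{..<n}. normal_cond_cdf \<rho> (fst p j) (snd p j)) *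
      (\<Prod>j<n. ennreal (c2 (fst p j) (snd p j))) \<partial>(PiM {..<n} (\<lambda>_. uniform01) \<Otimes>\<^sub>M PiM {..<n} (\<lambda>_. uniform01))) =
    (\<integral>\<^sup>+u. f u \<partial>PiM {..<n} (\<lambda>_. uniform01)) * (\<integral>\<^sup>+w. g w \<partial>PiM {..<n} (\<lambda>_. uniform01))"
proof -
  let ?U = "uniform01" and ?I = "{..<n}"
  let ?Un = "PiM ?I (\<lambda>_. ?U)" and ?UU = "?U \<Otimes>\<^sub>M ?U" and ?BB = "PiM ?I (\<lambda>_. borel \<Otimes>\<^sub>M borel :: (real \<times> real) measure)"
  let ?zip = "\<lambda>(u, v). \<lambda>j\<in>?I. (u j, v j)"
  let ?T = "\<lambda>(u, v). (u, normal_cond_cdf \<rho> u v)"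
  interpret U: prob_space ?U by (rule prob_space_uniform01)
  interpret UU: pair_prob_space ?U ?U ..
  interpret Un: prob_space ?Un by (rule prob_space_uniform_PiM)
  have sets_UU [simp, measurable_cong]: "sets ?UU = sets (borel \<Otimes>\<^sub>M borel)" by (simp cong: sets_pair_measure_cong)
  have sets_PUU [simp, measurable_cong]: "sets (PiM ?I (\<lambda>_. ?UU)) = sets ?BB" by (simp cong: sets_PiM_cong)
  define d where "d p = ennreal (c2 (fst p) (snd p))" for p
  have d[measurable]: "d \<in> borel_measurable (borel \<Otimes>\<^sub>M borel)"
    using measurable_compose[OF c2 measurable_ennreal] by (simp add: d_def[abs_def] case_prod_beta')
  define Q where "Q = density ?UU d"
  have Q: "Q = bivariate_normal_copula_law \<rho>"
    unfolding C[symmetric] by (simp add: Q_def d_def[abs_def] bivariate_copula_law_def case_prod_beta')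
  have sets_Q [simp, measurable_cong]: "sets Q = sets (borel \<Otimes>\<^sub>M borel)" by (simp add: Q_def)
  have Q_prob: "prob_space Q"
    unfolding Q bivariate_normal_copula_law_def by (rule UU.prob_space_distr) simp
  have PQ: "PiM ?I (\<lambda>_. Q) = density (PiM ?I (\<lambda>_. ?UU)) (\<lambda>w. \<Prod>j<n. d (w j))"
    unfolding Q_def
  proof (rule PiM_density)
    show "sigma_finite_measure ?UU" by unfold_locales
    show "sigma_finite_measure (density ?UU d)"
      using Q_prob unfolding Q_def by (rule prob_space_imp_sigma_finite)
  qed simp_all
  have zip: "distr (?Un \<Otimes>\<^sub>M ?Un) (PiM ?I (\<lambda>_. ?UU)) ?zip = PiM ?I (\<lambda>_. ?UU)"
    by (rule distr_PiM_zip) (simp_all add: U.sigma_finite_measure_axioms)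
  have zip_meas [measurable]: "?zip \<in> measurable (?Un \<Otimes>\<^sub>M ?Un) (PiM ?I (\<lambda>_. ?UU))"
    by measurable
  have T: "distr (PiM ?I (\<lambda>_. Q)) ?BB (\<lambda>w. \<lambda>j\<in>?I. ?T (w j)) = PiM ?I (\<lambda>_. ?UU)"
    by (subst distr_PiM_componentwise)
      (simp_all add: Q_prob distr_bivariate_normal_copula_law[OF \<rho>, folded Q])
  have sets_PQ [simp, measurable_cong]: "sets (PiM ?I (\<lambda>_. Q)) = sets ?BB" by (simp cong: sets_PiM_cong)
  have [measurable]: "(\<lambda>w. \<lambda>j\<in>?I. ?T (w j)) \<in> measurable ?BB ?BB"
    by measurable
  define F where "F w = f (\<lambda>j\<in>?I. fst (w j)) * g (\<lambda>j\<in>?I. snd (w j))" for w :: "nat \<Rightarrow> real \<times> real"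
  have F[measurable]: "F \<in> borel_measurable ?BB" unfolding F_def by measurable
  \<comment> \<open>Unzipping returns the original vectors because points of the product space are
    extensional.\<close>
  have zip_fst: "(\<lambda>j\<in>?I. fst (?zip p j)) = fst p" and zip_snd: "(\<lambda>j\<in>?I. snd (?zip p j)) = snd p"
    if "p \<in> space (?Un \<Otimes>\<^sub>M ?Un)" for p
  proof -
    obtain u v where p: "p = (u, v)" by (cases p)
    have "u \<in> extensional ?I" "v \<in> extensional ?I"
      using that by (auto simp: p space_pair_measure space_PiM PiE_def)
    then have "restrict u ?I = u" "restrict v ?I = v" by (simp_all add: extensional_restrict)
    moreover have "(\<lambda>j\<in>?I. fst (?zip p j)) = restrict u ?I" "(\<lambda>j\<in>?I. snd (?zip p j)) = restrict v ?I"
      by (simp_all add: p cong: restrict_cong)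
    ultimately show "(\<lambda>j\<in>?I. fst (?zip p j)) = fst p" "(\<lambda>j\<in>?I. snd (?zip p j)) = snd p" by (simp_all add: p)
  qed
  have "(\<integral>\<^sup>+p. f (fst p) * g (\<lambda>j\<in>?I. normal_cond_cdf \<rho> (fst p j) (snd p j)) *
      (\<Prod>j<n. ennreal (c2 (fst p j) (snd p j))) \<partial>(?Un \<Otimes>\<^sub>M ?Un)) =
    (\<integral>\<^sup>+p. F (\<lambda>j\<in>?I. ?T (?zip p j)) * (\<Prod>j<n. d (?zip p j)) \<partial>(?Un \<Otimes>\<^sub>M ?Un))"
  proof (rule nn_integral_cong)
    fix p assume p: "p \<in> space (?Un \<Otimes>\<^sub>M ?Un)"
    have "(\<lambda>j\<in>?I. fst ((\<lambda>j\<in>?I. ?T (?zip p j)) j)) = fst p"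
      unfolding zip_fst[OF p, symmetric] by (intro restrict_ext) (simp split: prod.splits)
    moreover have "(\<lambda>j\<in>?I. snd ((\<lambda>j\<in>?I. ?T (?zip p j)) j)) = (\<lambda>j\<in>?I. normal_cond_cdf \<rho> (fst p j) (snd p j))"
      by (intro restrict_ext) (simp split: prod.splits)
    moreover have "(\<Prod>j<n. d (?zip p j)) = (\<Prod>j<n. ennreal (c2 (fst p j) (snd p j)))"
      by (intro prod.cong) (auto simp: d_def split: prod.splits)
    ultimately show "f (fst p) * g (\<lambda>j\<in>?I. normal_cond_cdf \<rho> (fst p j) (snd p j)) * (\<Prod>j<n. ennreal (c2 (fst p j) (snd p j))) =
      F (\<lambda>j\<in>?I. ?T (?zip p j)) * (\<Prod>j<n. d (?zip p j))"
      unfolding F_def by simp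
  qed
  also have "\<dots> = (\<integral>\<^sup>+w. F (\<lambda>j\<in>?I. ?T (w j)) * (\<Prod>j<n. d (w j)) \<partial>PiM ?I (\<lambda>_. ?UU))"
    by (subst zip[symmetric], subst nn_integral_distr) simp_all
  also have "\<dots> = (\<integral>\<^sup>+w. F (\<lambda>j\<in>?I. ?T (w j)) \<partial>PiM ?I (\<lambda>_. Q))"
    unfolding PQ by (subst nn_integral_density) (simp_all add: mult.commute)
  also have "\<dots> = (\<integral>\<^sup>+w. F w \<partial>PiM ?I (\<lambda>_. ?UU))"
    unfolding T[symmetric] by (subst nn_integral_distr) simp_all
  also have "\<dots> = (\<integral>\<^sup>+p. F (?zip p) \<partial>(?Un \<Otimes>\<^sub>M ?Un))"
    by (subst zip[symmetric], subst nn_integral_distr) simp_all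
  also have "\<dots> = (\<integral>\<^sup>+p. f (fst p) * g (snd p) \<partial>(?Un \<Otimes>\<^sub>M ?Un))"
    by (intro nn_integral_cong) (simp add: F_def zip_fst zip_snd del: restrict_apply)
  also have "\<dots> = (\<integral>\<^sup>+u. \<integral>\<^sup>+w. f u * g w \<partial>?Un \<partial>?Un)"
    by (subst Un.nn_integral_fst[symmetric]) simp_all
  also have "\<dots> = (\<integral>\<^sup>+u. f u \<partial>?Un) * (\<integral>\<^sup>+w. g w \<partial>?Un)"
    by (simp add: nn_integral_cmult nn_integral_multc)
  finally show ?thesis .
qed

section \<open>Passage from Lebesgue densities to laws on the unit cube\<close>

lemma PiM_uniform01_eq_density:
  "PiM {..<n} (\<lambda>_. uniform01) = density (vec_lborel n) (\<lambda>u. \<Prod>j<n. indicator {0<..<1} (u j))"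
  unfolding uniform01_eq_density
proof (rule PiM_density)
  show "sigma_finite_measure (density lborel (indicator {0<..<1::real}))"
    using prob_space_uniform01 unfolding uniform01_eq_density by (rule prob_space_imp_sigma_finite)
qed (simp_all add: sigma_finite_lborel)

lemma nn_integral_copula_law:
  assumes "c \<in> borel_measurable (vec_borel n)" "f \<in> borel_measurable (vec_borel n)"
  shows "(\<integral>\<^sup>+u. f u \<partial>copula_law n c) = (\<integral>\<^sup>+u. ennreal (c u) * f u \<partial>PiM {..<n} (\<lambda>_. uniform01))"
  unfolding copula_law_def using assms
  by (subst nn_integral_density) (auto cong: measurable_cong_sets)

lemma sets_copula_law [simp, measurable_cong]: "sets (copula_law n c) = sets (vec_borel n)"
  by (simp add: copula_law_def)

lemma space_copula_law [simp]: "space (copula_law n c) = space (vec_borel n)"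
  by (rule sets_eq_imp_space_eq) simp

lemma sets_vec_lborel [simp, measurable_cong]: "sets (vec_lborel n) = sets (vec_borel n)"
  by (simp cong: sets_PiM_cong)

lemma space_vec_lborel [simp]: "space (vec_lborel n) = space (vec_borel n)"
  by (rule sets_eq_imp_space_eq) simp

lemma sigma_finite_vec_lborel: "sigma_finite_measure (vec_lborel n)"
proof -
  interpret product_sigma_finite "\<lambda>_::nat. lborel :: real measure"
    by (simp add: product_sigma_finite_def sigma_finite_lborel)
  show ?thesis by (rule sigma_finite) simp
qed

text \<open>With indicators for f and g this is the independence of U and W. The cut-off of the
  joint density to the unit cube is matched with the indicators in the Lebesgue density of the
  uniform law.\<close>

lemma nn_integral_two_exchangeable:
  fixes f g :: "(nat \<Rightarrow> real) \<Rightarrow> ennreal"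
  assumes \<rho>: "\<rho> \<in> {-1<..<1}"
    and C: "bivariate_copula C2 c2"
    and C2: "\<forall>u\<in>{0..1}. \<forall>v\<in>{0..1}. C2 u v = bivariate_normal_copula \<rho> u v"
    and c1: "copula_density n (c1 n)" and c3: "copula_density n (c3 n)"
    and meas: "(\<lambda>(u, v). ennreal (two_exchangeable_density n c1 C2 c2 c3 u v)) \<in> borel_measurable (vec_lborel n \<Otimes>\<^sub>M vec_lborel n)"
    and f [measurable]: "f \<in> borel_measurable (vec_borel n)"
    and g [measurable]: "g \<in> borel_measurable (vec_borel n)"
  shows "(\<integral>\<^sup>+p. f (fst p) * g (\<lambda>j\<in>{..<n}. normal_cond_cdf \<rho> (fst p j) (snd p j))
      \<partial>density (vec_lborel n \<Otimes>\<^sub>M vec_lborel n) (\<lambda>(u, v). ennreal (two_exchangeable_density n c1 C2 c2 c3 u v))) =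
    (\<integral>\<^sup>+u. f u \<partial>copula_law n (c1 n)) * (\<integral>\<^sup>+w. g w \<partial>copula_law n (c3 n))"
proof -
  let ?I = "{..<n}" and ?Un = "PiM {..<n} (\<lambda>_. uniform01)" and ?L = "vec_lborel n"
  let ?H = "\<lambda>p. \<lambda>j\<in>?I. normal_cond_cdf \<rho> (fst p j) (snd p j)"
  let ?ind = "\<lambda>u :: nat \<Rightarrow> real. \<Prod>j<n. indicator {0<..<1} (u j) :: ennreal"
  have c1m[measurable]: "c1 n \<in> borel_measurable (vec_borel n)" and c1n: "\<And>u. u \<in> PiE ?I (\<lambda>_. {0<..<1}) \<Longrightarrow> 0 \<le> c1 n u"
    and c3m[measurable]: "c3 n \<in> borel_measurable (vec_borel n)" and c3n: "\<And>u. u \<in> PiE ?I (\<lambda>_. {0<..<1}) \<Longrightarrow> 0 \<le> c3 n u"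
    using c1 c3 by (auto simp: copula_density_def)
  have c2m: "case_prod c2 \<in> borel_measurable (borel \<Otimes>\<^sub>M borel)"
    and c2n: "\<And>u v. u \<in> {0<..<1} \<Longrightarrow> v \<in> {0<..<1} \<Longrightarrow> 0 \<le> c2 u v"
    using C by (auto simp: bivariate_copula_def)
  have c2m'[measurable]: "(\<lambda>p. c2 (fst p) (snd p)) \<in> borel_measurable (borel \<Otimes>\<^sub>M borel)"
    using c2m by (simp add: case_prod_beta')
  have c2j[measurable]: "(\<lambda>p. c2 (fst p j) (snd p j)) \<in> borel_measurable (vec_borel n \<Otimes>\<^sub>M vec_borel n)" if "j < n" for j
  proof -
    have "(\<lambda>p. (fst p j, snd p j)) \<in> measurable (vec_borel n \<Otimes>\<^sub>M vec_borel n) (borel \<Otimes>\<^sub>M borel)"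
      using that by (intro measurable_Pair measurable_compose[OF measurable_fst measurable_component_singleton]
          measurable_compose[OF measurable_snd measurable_component_singleton]) auto
    from measurable_compose[OF this c2m'] show ?thesis by simp
  qed
  have H[measurable]: "?H \<in> measurable (vec_borel n \<Otimes>\<^sub>M vec_borel n) (vec_borel n)"
    by measurable
  have "(\<integral>\<^sup>+u. f u \<partial>copula_law n (c1 n)) * (\<integral>\<^sup>+w. g w \<partial>copula_law n (c3 n)) =
    (\<integral>\<^sup>+u. ennreal (c1 n u) * f u \<partial>?Un) * (\<integral>\<^sup>+w. ennreal (c3 n w) * g w \<partial>?Un)"
    by (simp add: nn_integral_copula_law)
  also have "\<dots> = (\<integral>\<^sup>+p. (ennreal (c1 n (fst p)) * f (fst p)) * (ennreal (c3 n (?H p)) * g (?H p)) *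
      (\<Prod>j<n. ennreal (c2 (fst p j) (snd p j))) \<partial>(?Un \<Otimes>\<^sub>M ?Un))"
    by (rule nn_integral_bivariate_normal_copula_product[OF \<rho> bivariate_copula_law_eq_normal[OF C \<rho> C2] c2m, symmetric])
      measurable
  also have "?Un \<Otimes>\<^sub>M ?Un = density (?L \<Otimes>\<^sub>M ?L) (\<lambda>(u, v). ?ind u * ?ind v)"
    unfolding PiM_uniform01_eq_density
  proof (rule pair_measure_density)
    show "sigma_finite_measure (density ?L ?ind)"
      unfolding PiM_uniform01_eq_density[symmetric] by (intro prob_space_imp_sigma_finite prob_space_uniform_PiM)
  qed (use sigma_finite_vec_lborel in measurable)
  also have "(\<integral>\<^sup>+p. (ennreal (c1 n (fst p)) * f (fst p)) * (ennreal (c3 n (?H p)) * g (?H p)) *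
      (\<Prod>j<n. ennreal (c2 (fst p j) (snd p j))) \<partial>density (?L \<Otimes>\<^sub>M ?L) (\<lambda>(u, v). ?ind u * ?ind v)) =
    (\<integral>\<^sup>+p. (case p of (u, v) \<Rightarrow> ?ind u * ?ind v) * ((ennreal (c1 n (fst p)) * f (fst p)) * (ennreal (c3 n (?H p)) * g (?H p)) *
      (\<Prod>j<n. ennreal (c2 (fst p j) (snd p j)))) \<partial>(?L \<Otimes>\<^sub>M ?L))"
    by (rule nn_integral_density) measurable
  also have "\<dots> = (\<integral>\<^sup>+p. (case p of (u, v) \<Rightarrow> ennreal (two_exchangeable_density n c1 C2 c2 c3 u v)) * (f (fst p) * g (?H p)) \<partial>(?L \<Otimes>\<^sub>M ?L))"
  proof (rule nn_integral_cong)
    fix p assume p: "p \<in> space (?L \<Otimes>\<^sub>M ?L)"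
    obtain u v where uv: "p = (u, v)" by (cases p)
    have ext: "u \<in> extensional ?I" "v \<in> extensional ?I"
      using p by (auto simp: uv space_pair_measure space_PiM PiE_def)
    show "(case p of (u, v) \<Rightarrow> ?ind u * ?ind v) * ((ennreal (c1 n (fst p)) * f (fst p)) * (ennreal (c3 n (?H p)) * g (?H p)) *
        (\<Prod>j<n. ennreal (c2 (fst p j) (snd p j)))) =
      (case p of (u, v) \<Rightarrow> ennreal (two_exchangeable_density n c1 C2 c2 c3 u v)) * (f (fst p) * g (?H p))"
    proof (cases "\<forall>j<n. u j \<in> {0<..<1} \<and> v j \<in> {0<..<1}")
      case True
      have ind: "?ind u = 1" "?ind v = 1" using True by (auto intro!: prod.neutral)
      have cond: "(\<lambda>j\<in>?I. cond_cdf_2_1 C2 (v j) (u j)) = ?H p"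
        using True by (auto simp: uv fun_eq_iff cond_cdf_bivariate_normal_copula[OF \<rho> _ _ C2])
      \<comment> \<open>Splitting \<open>ennreal\<close> over the product uses nonnegative factors,
        and the densities are known to be nonnegative only on the open cube. For c3 this works
        because \<open>normal_cond_cdf\<close> takes its values in the open unit interval.\<close>
      have n1: "0 \<le> c1 n u" using True ext by (intro c1n) (auto simp: PiE_def)
      have n2: "0 \<le> (\<Prod>j<n. c2 (u j) (v j))" using True by (intro prod_nonneg ballI c2n) auto
      have "?H p \<in> PiE ?I (\<lambda>_. {0<..<1})"
        by (intro restrict_PiE_iff[THEN iffD2] ballI normal_cond_cdf_in_unit)
      then have n3: "0 \<le> c3 n (?H p)" by (rule c3n)
      have d: "two_exchangeable_density n c1 C2 c2 c3 u v = c1 n u * (\<Prod>j<n. c2 (u j) (v j)) * c3 n (?H p)"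
        unfolding two_exchangeable_density_def cond[symmetric] using True by (rule if_P)
      then have "ennreal (two_exchangeable_density n c1 C2 c2 c3 u v) =
          ennreal (c1 n u) * (\<Prod>j<n. ennreal (c2 (u j) (v j))) * ennreal (c3 n (?H p))"
      proof -
        have "(\<Prod>j<n. ennreal (c2 (u j) (v j))) = ennreal (\<Prod>j<n. c2 (u j) (v j))"
          by (rule prod_ennreal) (use True in \<open>auto intro!: c2n\<close>)
        with d n1 n2 n3 show ?thesis by (simp add: ennreal_mult)
      qed
      then show ?thesis by (simp add: uv ind mult_ac)
    next
      case False
      then have "two_exchangeable_density n c1 C2 c2 c3 u v = 0"
        unfolding two_exchangeable_density_def by (rule if_not_P)
      \<comment> \<open>Off the cube some coordinate indicator vanishes, whatever values the
        densities take there.\<close>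
      moreover have "?ind u * ?ind v = 0"
      proof -
        have "?ind w = 0" if "j < n" "w j \<notin> {0<..<1}" for j and w :: "nat \<Rightarrow> real"
          by (intro prod_zero bexI[of _ j]) (use that in auto)
        then have "?ind u = 0 \<or> ?ind v = 0" using False by blast
        then show ?thesis by auto
      qed
      ultimately show ?thesis by (simp add: uv)
    qed
  qed
  also have "\<dots> = (\<integral>\<^sup>+p. f (fst p) * g (?H p)
      \<partial>density (?L \<Otimes>\<^sub>M ?L) (\<lambda>(u, v). ennreal (two_exchangeable_density n c1 C2 c2 c3 u v)))"
    by (rule nn_integral_density[symmetric, OF meas]) measurable
  finally show ?thesis by simp
qed

section \<open>Conditional laws\<close>

lemma regular_cond_law_cong:
  assumes "regular_cond_law M S X T Y K" and "\<And>x. x \<in> space S \<Longrightarrow> K x = K' x"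
  shows "regular_cond_law M S X T Y K'"
  using assms unfolding regular_cond_law_def
  by (auto cong: measurable_cong intro!: nn_integral_cong)

text \<open>The substitution rule for conditional laws: with W independent of X, freezing X at x
  leaves h x W, whose law is the kernel at x. That W has law L is the case A = space S of the
  product formula.\<close>

lemma regular_cond_law_indep:
  assumes "prob_space M" and X [measurable]: "X \<in> measurable M S" and W [measurable]: "W \<in> measurable M T"
    and L: "prob_space L" and sets_L [measurable_cong]: "sets L = sets T"
    and indep: "\<And>A B. A \<in> sets S \<Longrightarrow> B \<in> sets T \<Longrightarrow>
      emeasure M (X -` A \<inter> W -` B \<inter> space M) = emeasure M (X -` A \<inter> space M) * emeasure L B"
    and h [measurable]: "(\<lambda>(x, w). h x w) \<in> measurable (S \<Otimes>\<^sub>M T) T'"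
    and Y: "\<And>\<omega>. \<omega> \<in> space M \<Longrightarrow> Y \<omega> = h (X \<omega>) (W \<omega>)"
  shows "regular_cond_law M S X T' Y (\<lambda>x. distr L T' (h x))"
  unfolding regular_cond_law_def
proof (intro conjI ballI)
  interpret M: prob_space M by fact
  interpret L: prob_space L by fact
  interpret DX: prob_space "distr M S X" by (rule M.prob_space_distr) fact
  \<comment> \<open>The product formula on rectangles determines the joint law, both factors being
    sigma-finite.\<close>
  have joint: "distr M S X \<Otimes>\<^sub>M L = distr M (S \<Otimes>\<^sub>M T) (\<lambda>\<omega>. (X \<omega>, W \<omega>))"
  proof (rule pair_measure_eqI)
    show "sets (distr M S X \<Otimes>\<^sub>M L) = sets (distr M (S \<Otimes>\<^sub>M T) (\<lambda>\<omega>. (X \<omega>, W \<omega>)))"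
      using sets_L by (simp cong: sets_pair_measure_cong)
    fix A B assume A: "A \<in> sets (distr M S X)" and B: "B \<in> sets L"
    have "(\<lambda>\<omega>. (X \<omega>, W \<omega>)) -` (A \<times> B) \<inter> space M = X -` A \<inter> W -` B \<inter> space M" by auto
    then show "emeasure (distr M S X) A * emeasure L B = emeasure (distr M (S \<Otimes>\<^sub>M T) (\<lambda>\<omega>. (X \<omega>, W \<omega>))) (A \<times> B)"
      using A B sets_L by (simp add: emeasure_distr indep)
  qed (unfold_locales)
  show "X \<in> measurable M S" by fact
  have "(\<lambda>\<omega>. h (X \<omega>) (W \<omega>)) \<in> measurable M T'" by measurable
  then show "Y \<in> measurable M T'" using Y by (simp cong: measurable_cong)
  have "(\<lambda>x. L) \<in> measurable S (prob_algebra T)"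
    using L sets_L by (intro measurable_const) (simp add: space_prob_algebra)
  then show "(\<lambda>x. distr L T' (h x)) \<in> measurable S (prob_algebra T')"
    by (rule measurable_distr_prob_space2) (rule h)
  fix A B assume A[measurable]: "A \<in> sets S" and B[measurable]: "B \<in> sets T'"
  have C[measurable]: "{p \<in> space (S \<Otimes>\<^sub>M T). fst p \<in> A \<and> (case p of (x, w) \<Rightarrow> h x w) \<in> B} \<in> sets (S \<Otimes>\<^sub>M T)" (is "?C \<in> _")
    by measurable
  have sets_XL: "sets (distr M S X \<Otimes>\<^sub>M L) = sets (S \<Otimes>\<^sub>M T)" by (simp cong: sets_pair_measure_cong add: sets_L)
  have "X -` A \<inter> Y -` B \<inter> space M = (\<lambda>\<omega>. (X \<omega>, W \<omega>)) -` ?C \<inter> space M"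
    using measurable_space[OF X] measurable_space[OF W] Y by (auto simp: space_pair_measure)
  then have "emeasure M (X -` A \<inter> Y -` B \<inter> space M) = emeasure (distr M S X \<Otimes>\<^sub>M L) ?C"
    unfolding joint by (simp add: emeasure_distr)
  also have "\<dots> = (\<integral>\<^sup>+x. emeasure L (Pair x -` ?C) \<partial>distr M S X)"
    using C by (intro L.emeasure_pair_measure_alt) (simp add: sets_XL)
  also have "\<dots> = (\<integral>\<^sup>+x\<in>A. emeasure (distr L T' (h x)) B \<partial>distr M S X)"
  proof (rule nn_integral_cong)
    fix x assume "x \<in> space (distr M S X)"
    then have x: "x \<in> space S" by simp
    have hx: "h x \<in> measurable L T'" using x by measurable
    have "Pair x -` ?C = (if x \<in> A then h x -` B \<inter> space L else {})"
      using x sets_eq_imp_space_eq[OF sets_L] by (auto simp: space_pair_measure)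
    then show "emeasure L (Pair x -` ?C) = emeasure (distr L T' (h x)) B * indicator A x"
      using hx by (simp add: emeasure_distr)
  qed
  finally show "emeasure M (X -` A \<inter> Y -` B \<inter> space M) = (\<integral>\<^sup>+x\<in>A. emeasure (distr L T' (h x)) B \<partial>distr M S X)" .
qed

lemma regular_cond_law_const:
  assumes "prob_space M" "X \<in> measurable M S" "W \<in> measurable M T"
    and L: "prob_space L" "sets L = sets T"
    and "\<And>A B. A \<in> sets S \<Longrightarrow> B \<in> sets T \<Longrightarrow>
      emeasure M (X -` A \<inter> W -` B \<inter> space M) = emeasure M (X -` A \<inter> space M) * emeasure L B"
  shows "regular_cond_law M S X T W (\<lambda>_. L)"
proof -
  have "regular_cond_law M S X T W (\<lambda>x. distr L T (\<lambda>w. w))"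
    by (rule regular_cond_law_indep[OF assms]) (auto simp: case_prod_beta')
  moreover have "distr L T (\<lambda>w. w) = L" by (rule distr_id2) (simp add: L)
  ultimately show ?thesis by simp
qed

section \<open>Normal margins and the random intercept\<close>

lemma PiM_normal_eq_density:
  assumes "0 < \<sigma>"
  shows "PiM {..<n} (\<lambda>j. density lborel (normal_density (m j) \<sigma>)) =
    density (vec_lborel n) (\<lambda>y. ennreal (\<Prod>j<n. normal_density (m j) \<sigma> (y j)))"
proof -
  have "PiM {..<n} (\<lambda>j. density lborel (normal_density (m j) \<sigma>)) =
    density (vec_lborel n) (\<lambda>y. \<Prod>j<n. ennreal (normal_density (m j) \<sigma> (y j)))"
  proof (rule PiM_density)
    show "sigma_finite_measure (density lborel (normal_density (m i) \<sigma>))" for i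
      using assms by (intro prob_space_imp_sigma_finite prob_space_normal_density)
  qed (simp_all add: sigma_finite_lborel)
  then show ?thesis by (simp add: prod_ennreal)
qed

text \<open>A change of variables without Jacobians: the uniform law on the cube is the image of a
  product of normal laws under the standardised \<Phi>, so the copula law is the image of that
  product weighted by c composed with this map, and the quantile map undoes it.\<close>

lemma distr_copula_law_normal_margins:
  assumes c [measurable]: "c \<in> borel_measurable (vec_borel n)" and \<sigma>: "0 < \<sigma>"
  shows "distr (copula_law n c) (vec_borel n) (\<lambda>w. \<lambda>j\<in>{..<n}. m j + \<sigma> * std_normal_quantile (w j)) =
    density (vec_lborel n) (\<lambda>y. ennreal ((\<Prod>j<n. normal_density (m j) \<sigma> (y j)) *
      c (\<lambda>j\<in>{..<n}. \<Phi> ((y j - m j) / \<sigma>))))"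
proof -
  let ?N = "PiM {..<n} (\<lambda>j. density lborel (normal_density (m j) \<sigma>))"
  let ?\<Psi> = "\<lambda>y. \<lambda>j\<in>{..<n}. \<Phi> ((y j - m j) / \<sigma>)"
  let ?q = "\<lambda>w. \<lambda>j\<in>{..<n}. m j + \<sigma> * std_normal_quantile (w j)"
  have sets_N [simp, measurable_cong]: "sets ?N = sets (vec_borel n)" by (simp cong: sets_PiM_cong)
  have [measurable]: "?\<Psi> \<in> measurable (vec_borel n) (vec_borel n)" "?q \<in> measurable (vec_borel n) (vec_borel n)"
    by measurable
  have "distr (density lborel (normal_density (m j) \<sigma>)) borel (\<lambda>y. \<Phi> ((y - m j) / \<sigma>)) = uniform01" for j
    unfolding distr_std_normal_affine[OF \<sigma>, symmetric] distr_std_normal_Phi[symmetric]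
    using \<sigma> by (subst distr_distr) (auto simp: comp_def)
  then have "PiM {..<n} (\<lambda>_. uniform01) = PiM {..<n} (\<lambda>j. distr (density lborel (normal_density (m j) \<sigma>)) borel (\<lambda>y. \<Phi> ((y - m j) / \<sigma>)))"
    by simp
  also have "\<dots> = distr ?N (vec_borel n) ?\<Psi>"
    by (rule distr_PiM_componentwise[symmetric]) (use \<sigma> in \<open>auto intro: prob_space_normal_density\<close>)
  finally have "copula_law n c = density (distr ?N (vec_borel n) ?\<Psi>) (\<lambda>u. ennreal (c u))"
    by (simp add: copula_law_def)
  also have "\<dots> = distr (density ?N (\<lambda>y. ennreal (c (?\<Psi> y)))) (vec_borel n) ?\<Psi>"
    by (rule density_distr) measurable
  finally have "distr (copula_law n c) (vec_borel n) ?q =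
    distr (density ?N (\<lambda>y. ennreal (c (?\<Psi> y)))) (vec_borel n) (?q \<circ> ?\<Psi>)"
    by (simp add: distr_distr)
  also have "\<dots> = distr (density ?N (\<lambda>y. ennreal (c (?\<Psi> y)))) (vec_borel n) (\<lambda>y. y)"
  proof (rule distr_cong)
    fix y assume "y \<in> space (density ?N (\<lambda>y. ennreal (c (?\<Psi> y))))"
    then have "y \<in> extensional {..<n}" by (auto simp: space_PiM PiE_def)
    then show "(?q \<circ> ?\<Psi>) y = y" using \<sigma> by (auto simp: fun_eq_iff extensional_def)
  qed simp_all
  also have "\<dots> = density ?N (\<lambda>y. ennreal (c (?\<Psi> y)))"
    by (rule distr_id2) simp
  also have "\<dots> = density (vec_lborel n) (\<lambda>y. ennreal (\<Prod>j<n. normal_density (m j) \<sigma> (y j)) * ennreal (c (?\<Psi> y)))"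
    unfolding PiM_normal_eq_density[OF \<sigma>] by (rule density_density_eq) measurable
  \<comment> \<open>Only the normal factor is known to be nonnegative, which suffices for merging
    the two \<open>ennreal\<close> factors.\<close>
  finally show ?thesis by (simp add: ennreal_mult' prod_nonneg)
qed

lemma prod_normal_density:
  assumes "0 < \<sigma>"
  shows "(\<Prod>j<n. normal_density (m j) \<sigma> (y j)) =
    1 / ((2 * pi) powr (real n / 2) * \<sigma> ^ n) * exp (- 1 / (2 * \<sigma>\<^sup>2) * (\<Sum>j<n. (y j - m j)\<^sup>2))"
proof -
  \<comment> \<open>The real power is used because n / 2 need not be an integer.\<close>
  have "sqrt (2 * pi) ^ n = (2 * pi) powr (real n / 2)"
    by (simp add: powr_half_sqrt[symmetric] powr_realpow[symmetric] powr_powr)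
  then have k: "sqrt (2 * pi * \<sigma>\<^sup>2) ^ n = (2 * pi) powr (real n / 2) * \<sigma> ^ n"
    using assms by (simp add: real_sqrt_mult power_mult_distrib)
  have "(\<Prod>j<n. normal_density (m j) \<sigma> (y j)) =
    (1 / sqrt (2 * pi * \<sigma>\<^sup>2)) ^ n * exp (\<Sum>j<n. - (y j - m j)\<^sup>2 / (2 * \<sigma>\<^sup>2))"
    by (simp only: normal_density_def prod.distrib exp_sum finite_lessThan prod_constant card_lessThan)
  also have "(\<Sum>j<n. - (y j - m j)\<^sup>2 / (2 * \<sigma>\<^sup>2)) = - 1 / (2 * \<sigma>\<^sup>2) * (\<Sum>j<n. (y j - m j)\<^sup>2)"
    unfolding sum_distrib_left by simp
  finally show ?thesis unfolding power_one_over k .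
qed

text \<open>Given A = a the coordinates are independent normal with mean sqrt \<rho> * a and
  variance 1 - \<rho>; integrating over a leaves a multiple of exp (- exch_form n \<rho> s / 2). The
  index \<open>None\<close> stands for the intercept, \<open>Some j\<close> for the error of unit
  j.\<close>

lemma distr_random_intercept:
  fixes N :: "'b measure" and A :: "'b \<Rightarrow> real" and E :: "nat \<Rightarrow> 'b \<Rightarrow> real"
  assumes \<rho>: "0 \<le> \<rho>" "\<rho> < 1"
    and N: "prob_space N"
    and indep: "prob_space.indep_vars N (\<lambda>_. borel) (case_option A E) (insert None (Some ` {..<n}))"
    and A: "distributed N lborel A std_normal_density"
    and E: "\<forall>j<n. distributed N lborel (E j) std_normal_density"
    and R: "prob_space (centred_normal_law (exchangeable_corr_mat n \<rho>))"
  shows "distr N (vec_borel n) (\<lambda>\<omega>. \<lambda>j\<in>{..<n}. sqrt \<rho> * A \<omega> + sqrt (1 - \<rho>) * E j \<omega>) =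
    centred_normal_law (exchangeable_corr_mat n \<rho>)"
proof -
  interpret N: prob_space N by fact
  interpret Z: real_distribution N01 by (rule real_dist_normal_dist)
  interpret ZP: product_sigma_finite "\<lambda>_::nat option. N01"
    by (simp add: product_sigma_finite_def Z.sigma_finite_measure_axioms)
  let ?I = "{..<n}" and ?J = "insert None (Some ` {..<n})" and ?X = "case_option A E"
  let ?Y = "\<lambda>\<omega>. \<lambda>j\<in>?I. sqrt \<rho> * A \<omega> + sqrt (1 - \<rho>) * E j \<omega>"
  let ?d = "\<lambda>a s. ennreal (\<Prod>j<n. normal_density (sqrt \<rho> * a) (sqrt (1 - \<rho>)) (s j))"
  have X[measurable]: "?X i \<in> borel_measurable N" if "i \<in> ?J" for i
    using that A E by (auto simp: distributed_def)
  have X_law: "distr N borel (?X i) = N01" if "i \<in> ?J" for i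
  proof -
    have "distr N lborel (?X i) = N01" using that A E by (auto simp: distributed_def)
    moreover have "distr N lborel (?X i) = distr N borel (?X i)" by (intro distr_cong) auto
    ultimately show ?thesis by simp
  qed
  have joint: "distr N (PiM ?J (\<lambda>_. borel)) (\<lambda>\<omega>. \<lambda>i\<in>?J. ?X i \<omega>) = PiM ?J (\<lambda>_. N01)"
  proof -
    have "distr N (PiM ?J (\<lambda>_. borel)) (\<lambda>\<omega>. \<lambda>i\<in>?J. ?X i \<omega>) = PiM ?J (\<lambda>i. distr N borel (?X i))"
      using indep X by (subst (asm) N.indep_vars_iff_distr_eq_PiM') simp_all
    also have "\<dots> = PiM ?J (\<lambda>_. N01)" by (rule PiM_cong) (simp_all only: X_law)
    finally show ?thesis .
  qed
  define h where "h z = (\<lambda>j\<in>?I. sqrt \<rho> * z None + sqrt (1 - \<rho>) * z (Some j))" for z :: "nat option \<Rightarrow> real"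
  have h[measurable]: "h \<in> measurable (PiM ?J (\<lambda>_. borel)) (vec_borel n)"
    unfolding h_def by (intro measurable_restrict) simp
  have sJ [measurable_cong]: "sets (PiM ?J (\<lambda>_. N01)) = sets (PiM ?J (\<lambda>_. borel))" by (simp cong: sets_PiM_cong)
  have "distr N (vec_borel n) ?Y = distr (distr N (PiM ?J (\<lambda>_. borel)) (\<lambda>\<omega>. \<lambda>i\<in>?J. ?X i \<omega>)) (vec_borel n) h"
    by (subst distr_distr) (auto simp: comp_def h_def intro!: distr_cong measurable_restrict)
  then have law: "distr N (vec_borel n) ?Y = distr (PiM ?J (\<lambda>_. N01)) (vec_borel n) h"
    by (simp add: joint)
  obtain k \<tau> where \<tau>: "0 < \<tau>" and k: "\<And>s. \<exists>m. \<forall>a.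
    std_normal_density a * (\<Prod>j<n. normal_density (sqrt \<rho> * a) (sqrt (1 - \<rho>)) (s j)) =
    k * exp (- exch_form n \<rho> s / 2) * normal_density m \<tau> a"
    using random_intercept_density_eq[OF \<rho>] by blast
  \<comment> \<open>The factorisation supplies \<open>k\<close> without a sign; its left side is
    nonnegative and the factors next to \<open>k\<close> are positive.\<close>
  have k_nonneg: "0 \<le> k"
  proof -
    fix s :: "nat \<Rightarrow> real"
    obtain m where "std_normal_density 0 * (\<Prod>j<n. normal_density (sqrt \<rho> * 0) (sqrt (1 - \<rho>)) (s j)) =
      k * exp (- exch_form n \<rho> s / 2) * normal_density m \<tau> 0" using k by blast
    then have "0 \<le> k * (exp (- exch_form n \<rho> s / 2) * normal_density m \<tau> 0)"
      by (metis mult.assoc mult_nonneg_nonneg normal_density_nonneg prod_nonneg)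
    moreover have "0 < exp (- exch_form n \<rho> s / 2) * normal_density m \<tau> 0"
      using normal_density_pos[OF \<tau>] by simp
    ultimately show ?thesis unfolding zero_le_mult_iff by linarith
  qed
  \<comment> \<open>The posterior mean m varies with s, but the posterior density integrates to one
    for every mean.\<close>
  have mix: "(\<integral>\<^sup>+a. ennreal (std_normal_density a) * ?d a s \<partial>lborel) = ennreal (k * exp (- exch_form n \<rho> s / 2))" for s
  proof -
    obtain m where m: "\<And>a. std_normal_density a * (\<Prod>j<n. normal_density (sqrt \<rho> * a) (sqrt (1 - \<rho>)) (s j)) =
      k * exp (- exch_form n \<rho> s / 2) * normal_density m \<tau> a" using k[of s] by blast
    have "(\<integral>\<^sup>+a. ennreal (std_normal_density a) * ?d a s \<partial>lborel) =
      (\<integral>\<^sup>+a. ennreal (k * exp (- exch_form n \<rho> s / 2)) * ennreal (normal_density m \<tau> a) \<partial>lborel)"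
      by (intro nn_integral_cong) (simp only: ennreal_mult'[symmetric] normal_density_nonneg m k_nonneg mult_nonneg_nonneg exp_ge_zero)
    also have "\<dots> = ennreal (k * exp (- exch_form n \<rho> s / 2)) * (\<integral>\<^sup>+a. ennreal (normal_density m \<tau> a) \<partial>lborel)"
      by (rule nn_integral_cmult) simp
    also have "(\<integral>\<^sup>+a. ennreal (normal_density m \<tau> a) \<partial>lborel) = 1"
      using \<tau> by (subst nn_integral_eq_integral) auto
    finally show ?thesis by simp
  qed
  have "distr (PiM ?J (\<lambda>_. N01)) (vec_borel n) h = density (vec_lborel n) (\<lambda>s. ennreal (k * exp (- exch_form n \<rho> s / 2)))"
  proof (rule measure_eqI)
    fix S assume "S \<in> sets (distr (PiM ?J (\<lambda>_. N01)) (vec_borel n) h)"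
    then have S[measurable]: "S \<in> sets (vec_borel n)" by simp
    interpret V: sigma_finite_measure "vec_lborel n" by (rule sigma_finite_vec_lborel)
    interpret P: pair_sigma_finite lborel "vec_lborel n" ..
    have inner: "(\<integral>\<^sup>+z. indicator S (h (z(None := a))) \<partial>PiM (Some ` ?I) (\<lambda>_. N01)) =
      (\<integral>\<^sup>+s. ?d a s * indicator S s \<partial>vec_lborel n)" for a
    proof -
      let ?g = "\<lambda>e. \<lambda>j\<in>?I. sqrt \<rho> * a + sqrt (1 - \<rho>) * e j"
      have sI [measurable_cong]: "sets (PiM ?I (\<lambda>_. N01)) = sets (vec_borel n)" by (simp cong: sets_PiM_cong)
      have g[measurable]: "?g \<in> measurable (vec_borel n) (vec_borel n)" by measurable
      have "(\<integral>\<^sup>+z. indicator S (h (z(None := a))) \<partial>PiM (Some ` ?I) (\<lambda>_. N01)) =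
        (\<integral>\<^sup>+z. indicator S (?g (\<lambda>j\<in>?I. z (Some j))) \<partial>PiM (Some ` ?I) (\<lambda>_. N01))"
        by (intro nn_integral_cong arg_cong[where f = "indicator S"]) (simp add: h_def cong: restrict_cong)
      also have "\<dots> = (\<integral>\<^sup>+e. indicator S (?g e) \<partial>distr (PiM (Some ` ?I) (\<lambda>_. N01)) (PiM ?I (\<lambda>_. N01)) (\<lambda>z. \<lambda>j\<in>?I. z (Some j)))"
      proof (rule nn_integral_distr[symmetric])
        show "(\<lambda>z. \<lambda>j\<in>?I. z (Some j)) \<in> measurable (PiM (Some ` ?I) (\<lambda>_. N01)) (PiM ?I (\<lambda>_. N01))"
          by (intro measurable_restrict measurable_component_singleton imageI)
      qed measurable
      also have "distr (PiM (Some ` ?I) (\<lambda>_. N01)) (PiM ?I (\<lambda>_. N01)) (\<lambda>z. \<lambda>j\<in>?I. z (Some j)) = PiM ?I (\<lambda>_. N01)"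
        by (rule distr_PiM_reindex) (auto simp: prob_space_N01)
      also have "(\<integral>\<^sup>+e. indicator S (?g e) \<partial>PiM ?I (\<lambda>_. N01)) = (\<integral>\<^sup>+s. indicator S s \<partial>distr (PiM ?I (\<lambda>_. N01)) (vec_borel n) ?g)"
        by (rule nn_integral_distr[symmetric]) measurable
      also have "distr (PiM ?I (\<lambda>_. N01)) (vec_borel n) ?g = PiM ?I (\<lambda>_. density lborel (normal_density (sqrt \<rho> * a) (sqrt (1 - \<rho>))))"
        using \<rho> by (subst distr_PiM_componentwise) (simp_all add: prob_space_N01 distr_std_normal_affine)
      also have "\<dots> = density (vec_lborel n) (?d a)"
        using \<rho> by (intro PiM_normal_eq_density) simp
      also have "(\<integral>\<^sup>+s. indicator S s \<partial>density (vec_lborel n) (?d a)) = (\<integral>\<^sup>+s. ?d a s * indicator S s \<partial>vec_lborel n)"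
        by (rule nn_integral_density) measurable
      finally show ?thesis .
    qed
    have "emeasure (distr (PiM ?J (\<lambda>_. N01)) (vec_borel n) h) S = (\<integral>\<^sup>+s. indicator S s \<partial>distr (PiM ?J (\<lambda>_. N01)) (vec_borel n) h)"
      by simp
    also have "\<dots> = (\<integral>\<^sup>+z. indicator S (h z) \<partial>PiM ?J (\<lambda>_. N01))"
      by (rule nn_integral_distr) measurable
    also have "\<dots> = (\<integral>\<^sup>+a. \<integral>\<^sup>+z. indicator S (h (z(None := a))) \<partial>PiM (Some ` ?I) (\<lambda>_. N01) \<partial>N01)"
      by (rule ZP.product_nn_integral_insert_rev) (auto, measurable)
    also have "\<dots> = (\<integral>\<^sup>+a. \<integral>\<^sup>+s. ?d a s * indicator S s \<partial>vec_lborel n \<partial>N01)"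
      by (simp only: inner)
    also have "\<dots> = (\<integral>\<^sup>+a. ennreal (std_normal_density a) * (\<integral>\<^sup>+s. ?d a s * indicator S s \<partial>vec_lborel n) \<partial>lborel)"
      by (rule nn_integral_density) measurable
    also have "\<dots> = (\<integral>\<^sup>+a. \<integral>\<^sup>+s. ennreal (std_normal_density a) * ?d a s * indicator S s \<partial>vec_lborel n \<partial>lborel)"
      by (intro nn_integral_cong) (simp add: nn_integral_cmult mult.assoc)
    \<comment> \<open>Tonelli: with s outermost, the intercept can be integrated out for each s
      separately.\<close>
    also have "\<dots> = (\<integral>\<^sup>+s. \<integral>\<^sup>+a. ennreal (std_normal_density a) * ?d a s * indicator S s \<partial>lborel \<partial>vec_lborel n)"
      by (rule P.Fubini'[symmetric]) measurable
    also have "\<dots> = (\<integral>\<^sup>+s. ennreal (k * exp (- exch_form n \<rho> s / 2)) * indicator S s \<partial>vec_lborel n)"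
      by (intro nn_integral_cong) (subst nn_integral_multc, simp, simp only: mix)
    also have "\<dots> = emeasure (density (vec_lborel n) (\<lambda>s. ennreal (k * exp (- exch_form n \<rho> s / 2)))) S"
      by (rule emeasure_density[symmetric]) measurable
    finally show "emeasure (distr (PiM ?J (\<lambda>_. N01)) (vec_borel n) h) S =
      emeasure (density (vec_lborel n) (\<lambda>s. ennreal (k * exp (- exch_form n \<rho> s / 2)))) S" .
  qed simp
  with law have law': "distr N (vec_borel n) ?Y = density (vec_lborel n) (\<lambda>s. ennreal (k * exp (- exch_form n \<rho> s / 2)))"
    by simp
  have "?Y \<in> measurable N (vec_borel n)"
  proof (rule measurable_restrict)
    fix j assume "j \<in> ?I"
    then have [measurable]: "A \<in> borel_measurable N" "E j \<in> borel_measurable N"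
      using X[of None] X[of "Some j"] by auto
    show "(\<lambda>\<omega>. sqrt \<rho> * A \<omega> + sqrt (1 - \<rho>) * E j \<omega>) \<in> borel_measurable N" by measurable
  qed
  then have "prob_space (distr N (vec_borel n) ?Y)" by (rule N.prob_space_distr)
  moreover have "1 + (real n - 1) * \<rho> \<noteq> 0"
  proof -
    have "1 + (real n - 1) * \<rho> = (1 - \<rho>) + real n * \<rho>" by (simp add: algebra_simps)
    also have "\<dots> > 0" using \<rho> by (simp add: add_pos_nonneg)
    finally show ?thesis by simp
  qed
  \<comment> \<open>Both laws are probability measures with densities proportional to the same
    function, so the unknown constant \<open>k\<close> and the one with the determinant give the
    same law.\<close>
  ultimately show ?thesis
    using R \<rho> unfolding law' by (subst (asm) centred_normal_law_exchangeable, simp, simp)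
      (subst centred_normal_law_exchangeable, simp, simp, rule density_proportional_eq, auto)
qed

text \<open>The intercept and errors may live on a probability space \<open>N\<close> of their own,
  since part (b) concerns only their law; the W of part (a) has to live on M, together with X and
  Y.\<close>

theorem mainTheorem4:
  fixes M :: "'a measure" and N :: "'b measure" and n :: nat
    and X Y :: "nat \<Rightarrow> 'a \<Rightarrow> real"
    and F G :: "real \<Rightarrow> real"
    and c1 c3 :: "nat \<Rightarrow> (nat \<Rightarrow> real) \<Rightarrow> real"
    and C2 c2 :: "real \<Rightarrow> real \<Rightarrow> real"
    and \<mu>1 \<mu>2 \<sigma>1 \<sigma>2 \<rho>2 \<beta>0 \<beta>1 \<sigma>e :: real
    and A :: "'b \<Rightarrow> real" and E :: "nat \<Rightarrow> 'b \<Rightarrow> real"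
  assumes "1 \<le> n"
    and "two_exchangeable_copula_model M n F G c1 C2 c2 c3 X Y"
    and "\<rho>2 \<in> {-1<..<1}"
    and "\<forall>u\<in>{0..1}. \<forall>v\<in>{0..1}. C2 u v = bivariate_normal_copula \<rho>2 u v"
    and "0 < \<sigma>1" and "0 < \<sigma>2"
    and "\<And>x. F x = \<Phi> ((x - \<mu>1) / \<sigma>1)"
    and "\<And>y. G y = \<Phi> ((y - \<mu>2) / \<sigma>2)"
    and "\<beta>1 = \<rho>2 * \<sigma>2 / \<sigma>1"
    and "\<beta>0 = \<mu>2 - \<beta>1 * \<mu>1"
    and "\<sigma>e\<^sup>2 = \<sigma>2\<^sup>2 * (1 - \<rho>2\<^sup>2)" and "0 < \<sigma>e"
  shows "(\<exists>W :: nat \<Rightarrow> 'a \<Rightarrow> real.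
            (\<forall>\<omega>\<in>space M. \<forall>j<n. W j \<omega> \<in> {0<..<1} \<and>
               Y j \<omega> = \<beta>0 + \<beta>1 * X j \<omega> + \<sigma>e * std_normal_quantile (W j \<omega>)) \<and>
            regular_cond_law M (vec_borel n) (rvec n X) (vec_borel n) (rvec n W)
              (\<lambda>x. copula_law n (c3 n)))
       \<and> regular_cond_law M (vec_borel n) (rvec n X) (vec_borel n) (rvec n Y)
           (\<lambda>x. density (vec_lborel n) (\<lambda>y. ennreal (
              1 / ((2 * pi) powr (real n / 2) * \<sigma>e ^ n) *
              exp (- 1 / (2 * \<sigma>e\<^sup>2) * (\<Sum>j<n. (y j - \<beta>0 - \<beta>1 * x j)\<^sup>2)) *
              c3 n (\<lambda>j\<in>{..<n}. \<Phi> ((y j - \<beta>0 - \<beta>1 * x j) / \<sigma>e)))))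
       \<and> (\<forall>\<rho>3\<in>{0..<1}.
            copula_law n (c3 n) = normal_copula (exchangeable_corr_mat n \<rho>3) \<and>
            prob_space N \<and>
            prob_space.indep_vars N (\<lambda>_. borel) (case_option A E) (insert None (Some ` {..<n})) \<and>
            distributed N lborel A std_normal_density \<and>
            (\<forall>j<n. distributed N lborel (E j) std_normal_density)
            \<longrightarrow> regular_cond_law M (vec_borel n) (rvec n X) (vec_borel n) (rvec n Y)
                  (\<lambda>x. distr N (vec_borel n)
                     (rvec n (\<lambda>j \<omega>. \<beta>0 + \<beta>1 * x j + \<sigma>e * sqrt \<rho>3 * A \<omega>
                                        + \<sigma>e * sqrt (1 - \<rho>3) * E j \<omega>))))"
proof -
  note \<rho>2 = assms(3) and C2 = assms(4) and pos = assms(5,6) and F = assms(7) and G = assms(8)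
    and \<sigma>e = assms(12)
  let ?L = "copula_law n (c3 n)" and ?V = "vec_borel n"
  let ?d = "\<lambda>(u, v). ennreal (two_exchangeable_density n c1 C2 c2 c3 u v)"
  let ?U = "rvec n (\<lambda>j \<omega>. F (X j \<omega>))" and ?G = "rvec n (\<lambda>j \<omega>. G (Y j \<omega>))"
  let ?LL = "vec_lborel n \<Otimes>\<^sub>M vec_lborel n"
  have M: "prob_space M"
    and X[measurable]: "\<And>j. j < n \<Longrightarrow> X j \<in> borel_measurable M"
    and Y[measurable]: "\<And>j. j < n \<Longrightarrow> Y j \<in> borel_measurable M"
    and C: "bivariate_copula C2 c2"
    and c1: "copula_density n (c1 n)" and c3: "copula_density n (c3 n)"
    and UV: "distributed M ?LL (\<lambda>\<omega>. (?U \<omega>, ?G \<omega>)) ?d"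
    using assms(1,2) by (auto simp: two_exchangeable_copula_model_def one_exchangeable_family_def)
  interpret M: prob_space M by (rule M)
  have L: "prob_space ?L" and c3m: "c3 n \<in> borel_measurable ?V" using c3 by (auto simp: copula_density_def)
  have rX[measurable]: "rvec n X \<in> measurable M ?V" unfolding rvec_def by (intro measurable_restrict) simp
  \<comment> \<open>The rank of the standardised regression residual. Defined this way, W stays in
    the open unit interval and the equation for Y holds at every point, not just almost
    surely.\<close>
  define W where "W j \<omega> = \<Phi> ((Y j \<omega> - \<beta>0 - \<beta>1 * X j \<omega>) / \<sigma>e)" for j \<omega>
  have rW[measurable]: "rvec n W \<in> measurable M ?V" unfolding rvec_def W_def by (intro measurable_restrict) simp
  have \<sigma>e_eq: "\<sigma>e = \<sigma>2 * sqrt (1 - \<rho>2\<^sup>2)"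
    using assms(11) pos \<sigma>e by (metis abs_of_pos real_sqrt_abs real_sqrt_mult)
  have r: "0 < sqrt (1 - \<rho>2\<^sup>2)" using \<rho>2 by (rule sqrt_one_minus_square_pos)
  \<comment> \<open>The quantiles of F(X) and G(Y) are the standardised variables, and the values of
    \<beta>0, \<beta>1 and \<sigma>e are exactly those that turn the argument of \<Phi> in
    \<open>normal_cond_cdf\<close> into the residual.\<close>
  have W_eq: "W j \<omega> = normal_cond_cdf \<rho>2 (F (X j \<omega>)) (G (Y j \<omega>))" for j \<omega>
  proof -
    have "((Y j \<omega> - \<mu>2) / \<sigma>2 - \<rho>2 * ((X j \<omega> - \<mu>1) / \<sigma>1)) / sqrt (1 - \<rho>2\<^sup>2) = (Y j \<omega> - \<beta>0 - \<beta>1 * X j \<omega>) / \<sigma>e"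
      unfolding \<sigma>e_eq assms(10,9) using pos r by (simp add: field_simps)
    then show ?thesis by (simp add: W_def normal_cond_cdf_def F G)
  qed
  have indep: "emeasure M (rvec n X -` S \<inter> rvec n W -` T \<inter> space M) =
      emeasure M (rvec n X -` S \<inter> space M) * emeasure ?L T"
    if S[measurable]: "S \<in> sets ?V" and T[measurable]: "T \<in> sets ?V" for S T
  proof -
    \<comment> \<open>The inverse of the margin F in each coordinate; it recovers X from U, so that
      events about X become events about U.\<close>
    let ?x = "\<lambda>u. \<lambda>j\<in>{..<n}. \<mu>1 + \<sigma>1 * std_normal_quantile (u j)"
    let ?w = "\<lambda>p. \<lambda>j\<in>{..<n}. normal_cond_cdf \<rho>2 (fst p j) (snd p j)"
    have [measurable]: "?x \<in> measurable ?V ?V" by measurable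
    have [measurable]: "?w \<in> measurable (?V \<Otimes>\<^sub>M ?V) ?V" by measurable
    have dist: "distr M ?LL (\<lambda>\<omega>. (?U \<omega>, ?G \<omega>)) = density ?LL ?d"
      and d_meas: "?d \<in> borel_measurable ?LL" and UV_meas: "(\<lambda>\<omega>. (?U \<omega>, ?G \<omega>)) \<in> measurable M ?LL"
      using UV by (auto simp: distributed_def)
    have UV_meas'[measurable]: "(\<lambda>\<omega>. (?U \<omega>, ?G \<omega>)) \<in> measurable M (?V \<Otimes>\<^sub>M ?V)"
      using UV_meas by (simp cong: measurable_cong_sets sets_pair_measure_cong)
    have x: "?x (?U \<omega>) = rvec n X \<omega>" for \<omega>
      unfolding rvec_def using pos by (intro restrict_ext) (simp add: F)
    have w: "(\<lambda>j\<in>{..<n}. normal_cond_cdf \<rho>2 (?U \<omega> j) (?G \<omega> j)) = rvec n W \<omega>" for \<omega>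
      unfolding rvec_def by (intro restrict_ext) (simp add: W_eq)
    \<comment> \<open>The second event is kept general because the whole space is inserted for it
      later, which identifies the first factor as the probability of the event about X.\<close>
    have *: "emeasure M (rvec n X -` S \<inter> rvec n W -` T' \<inter> space M) =
        (\<integral>\<^sup>+u. indicator S (?x u) \<partial>copula_law n (c1 n)) * emeasure ?L T'" if T'[measurable]: "T' \<in> sets ?V" for T'
    proof -
      have "emeasure M (rvec n X -` S \<inter> rvec n W -` T' \<inter> space M) =
          (\<integral>\<^sup>+\<omega>. indicator (rvec n X -` S \<inter> rvec n W -` T' \<inter> space M) \<omega> \<partial>M)"
        by (rule nn_integral_indicator[symmetric]) measurable
      also have "\<dots> = (\<integral>\<^sup>+\<omega>. indicator S (?x (fst (?U \<omega>, ?G \<omega>))) * indicator T' (?w (?U \<omega>, ?G \<omega>)) \<partial>M)"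
        unfolding fst_conv snd_conv w x by (intro nn_integral_cong) (simp add: indicator_def)
      also have "\<dots> = (\<integral>\<^sup>+p. indicator S (?x (fst p)) * indicator T' (?w p) \<partial>distr M ?LL (\<lambda>\<omega>. (?U \<omega>, ?G \<omega>)))"
        by (rule nn_integral_distr[symmetric, OF UV_meas]) measurable
      also have "\<dots> = (\<integral>\<^sup>+u. indicator S (?x u) \<partial>copula_law n (c1 n)) * (\<integral>\<^sup>+w. indicator T' w \<partial>?L)"
        unfolding dist
        by (rule nn_integral_two_exchangeable[OF \<rho>2 C C2 c1 c3 d_meas, of "\<lambda>u. indicator S (?x u)" "indicator T'"]) measurable
      finally show ?thesis by simp
    qed
    have "rvec n X -` S \<inter> space M = rvec n X -` S \<inter> rvec n W -` space ?V \<inter> space M"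
      using measurable_space[OF rW] by auto
    moreover have "emeasure ?L (space ?V) = 1"
      using prob_space.emeasure_space_1[OF L] by simp
    ultimately show ?thesis using *[OF T] *[of "space ?V"] by simp
  qed
  have Y_eq: "Y j \<omega> = \<beta>0 + \<beta>1 * X j \<omega> + \<sigma>e * std_normal_quantile (W j \<omega>)" for j \<omega>
    using \<sigma>e by (simp add: W_def)
  let ?h = "\<lambda>x w. \<lambda>j\<in>{..<n}. (\<beta>0 + \<beta>1 * x j) + \<sigma>e * std_normal_quantile (w j)"
  have h_meas: "(\<lambda>(x, w). ?h x w) \<in> measurable (?V \<Otimes>\<^sub>M ?V) ?V"
    unfolding case_prod_beta' by measurable
  have Y_law: "regular_cond_law M ?V (rvec n X) ?V (rvec n Y) (\<lambda>x. distr ?L ?V (?h x))"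
  proof (rule regular_cond_law_indep[OF M rX rW L _ indep h_meas])
    show "rvec n Y \<omega> = ?h (rvec n X \<omega>) (rvec n W \<omega>)" for \<omega>
      unfolding rvec_def by (intro restrict_ext) (simp add: Y_eq[symmetric])
  qed simp_all
  show ?thesis
  proof (intro conjI ballI impI)
    show "\<exists>W. (\<forall>\<omega>\<in>space M. \<forall>j<n. W j \<omega> \<in> {0<..<1} \<and>
        Y j \<omega> = \<beta>0 + \<beta>1 * X j \<omega> + \<sigma>e * std_normal_quantile (W j \<omega>)) \<and>
        regular_cond_law M ?V (rvec n X) ?V (rvec n W) (\<lambda>x. ?L)"
    proof (intro exI[of _ W] conjI ballI allI impI)
      show "regular_cond_law M ?V (rvec n X) ?V (rvec n W) (\<lambda>x. ?L)"
        by (rule regular_cond_law_const[OF M rX rW L _ indep]) simp_all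
    qed (use Y_eq in \<open>simp_all add: W_def\<close>)
    show "regular_cond_law M ?V (rvec n X) ?V (rvec n Y)
       (\<lambda>x. density (vec_lborel n) (\<lambda>y. ennreal (
          1 / ((2 * pi) powr (real n / 2) * \<sigma>e ^ n) *
          exp (- 1 / (2 * \<sigma>e\<^sup>2) * (\<Sum>j<n. (y j - \<beta>0 - \<beta>1 * x j)\<^sup>2)) *
          c3 n (\<lambda>j\<in>{..<n}. \<Phi> ((y j - \<beta>0 - \<beta>1 * x j) / \<sigma>e)))))"
      by (rule regular_cond_law_cong[OF Y_law])
        (simp only: distr_copula_law_normal_margins[OF c3m \<sigma>e] prod_normal_density[OF \<sigma>e] diff_diff_add)
  next
    fix \<rho>3 :: real
    assume \<rho>3: "\<rho>3 \<in> {0..<1}" and "copula_law n (c3 n) = normal_copula (exchangeable_corr_mat n \<rho>3) \<and>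
            prob_space N \<and>
            prob_space.indep_vars N (\<lambda>_. borel) (case_option A E) (insert None (Some ` {..<n})) \<and>
            distributed N lborel A std_normal_density \<and>
            (\<forall>j<n. distributed N lborel (E j) std_normal_density)"
    then have nc: "?L = normal_copula (exchangeable_corr_mat n \<rho>3)" and N: "prob_space N"
      and ind: "prob_space.indep_vars N (\<lambda>_. borel) (case_option A E) (insert None (Some ` {..<n}))"
      and A: "distributed N lborel A std_normal_density"
      and E: "\<forall>j<n. distributed N lborel (E j) std_normal_density" by auto
    let ?R = "centred_normal_law (exchangeable_corr_mat n \<rho>3)"
    have dim: "dim_row (exchangeable_corr_mat n \<rho>3) = n" by (simp add: exchangeable_corr_mat_def)
    have sets_R [measurable_cong]: "sets ?R = sets ?V"
      by (simp add: centred_normal_law_def Let_def dim)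
    have space_R: "space ?R = space ?V" by (rule sets_eq_imp_space_eq) (rule sets_R)
    have \<Phi>_meas: "(\<lambda>s. \<lambda>j\<in>{..<n}. \<Phi> (s j)) \<in> measurable ?R ?V" by measurable
    have L_eq: "?L = distr ?R ?V (\<lambda>s. \<lambda>j\<in>{..<n}. \<Phi> (s j))"
      by (simp add: nc normal_copula_def dim)
    \<comment> \<open>A measure whose image is a probability measure is itself one. This fixes the
      normalisation of N(0, R) without evaluating its determinant.\<close>
    have R: "prob_space ?R"
      using prob_space_distrD[OF \<Phi>_meas] L unfolding L_eq by blast
    let ?Y = "\<lambda>\<omega>. \<lambda>j\<in>{..<n}. sqrt \<rho>3 * A \<omega> + sqrt (1 - \<rho>3) * E j \<omega>"
    have mix: "distr N ?V ?Y = ?R"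
      using \<rho>3 by (intro distr_random_intercept N ind A E R) auto
    have Y_meas: "?Y \<in> measurable N ?V"
    proof (rule measurable_restrict)
      fix j assume "j \<in> {..<n}"
      then have [measurable]: "A \<in> borel_measurable N" "E j \<in> borel_measurable N"
        using A E by (auto simp: distributed_def)
      show "(\<lambda>\<omega>. sqrt \<rho>3 * A \<omega> + sqrt (1 - \<rho>3) * E j \<omega>) \<in> borel_measurable N" by measurable
    qed
    show "regular_cond_law M ?V (rvec n X) ?V (rvec n Y)
      (\<lambda>x. distr N ?V (rvec n (\<lambda>j \<omega>. \<beta>0 + \<beta>1 * x j + \<sigma>e * sqrt \<rho>3 * A \<omega> + \<sigma>e * sqrt (1 - \<rho>3) * E j \<omega>)))"
    proof (rule regular_cond_law_cong[OF Y_law])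
      fix x assume "x \<in> space ?V"
      let ?t = "\<lambda>s. \<lambda>j\<in>{..<n}. (\<beta>0 + \<beta>1 * x j) + \<sigma>e * s j"
      have t_meas: "?t \<in> measurable ?V ?V" by measurable
      have hx_meas: "?h x \<in> measurable ?V ?V" by measurable
      \<comment> \<open>In the kernel of part (a) the quantile cancels the \<Phi> of the normal
        copula, leaving an affine image of N(0, R), which the random-intercept vector
        represents.\<close>
      have "distr ?L ?V (?h x) = distr ?R ?V (?h x \<circ> (\<lambda>s. \<lambda>j\<in>{..<n}. \<Phi> (s j)))"
        unfolding L_eq by (rule distr_distr[OF hx_meas \<Phi>_meas])
      also have "?h x \<circ> (\<lambda>s. \<lambda>j\<in>{..<n}. \<Phi> (s j)) = ?t"
        unfolding comp_def by (intro ext restrict_ext) simp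
      also have "distr ?R ?V ?t = distr N ?V (?t \<circ> ?Y)"
        unfolding mix[symmetric] by (rule distr_distr[OF t_meas Y_meas])
      also have "?t \<circ> ?Y = rvec n (\<lambda>j \<omega>. \<beta>0 + \<beta>1 * x j + \<sigma>e * sqrt \<rho>3 * A \<omega> + \<sigma>e * sqrt (1 - \<rho>3) * E j \<omega>)"
        unfolding comp_def rvec_def by (intro ext) (simp add: algebra_simps cong: restrict_cong)
      finally show "distr ?L ?V (?h x) = distr N ?V (rvec n (\<lambda>j \<omega>. \<beta>0 + \<beta>1 * x j + \<sigma>e * sqrt \<rho>3 * A \<omega> + \<sigma>e * sqrt (1 - \<rho>3) * E j \<omega>))" .
    qed
  qed
qed

end
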